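(* Let $m\geq 3$ be an odd integer. Then for all but finitely many primes $p$, the class number of $\mathbb{Q}(\sqrt{1-2m^p})$ is divisible by $p$. Moreover, for a fixed $m$, the collection of fields $\mathbb{Q}(\sqrt{1-2m^p})$ ($p$ prime) such that $p$ divides the class number of $\mathbb{Q}(\sqrt{1-2m^p})$ is infinite.
   Context: The class number of a number field is the order of its ideal class group. *)

theory Defs
  imports
    "HOL-Algebra.Algebra"
    "HOL-Algebra.Algebraic_Closure_Type"
    "HOL-Analysis.Analysis"
begin

text \<open>
  Number fields are represented as subfields of the complex numbers; \<open>ring_of_type_algebra\<close>
  packages the type \<^typ>\<open>complex\<close> as a ring record.
\<close>

abbreviation complex_ring :: "complex ring"
  where "complex_ring \<equiv> ring_of_type_algebra"

text \<open>
  The field \<open>\<rat>(\<surd>d)\<close>. A generated subfield contains 1, hence the rational numbers, and it does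
  not depend on the choice of the square root. Two quadratic subfields of \<^typ>\<open>complex\<close> are
  isomorphic if and only if they are equal as sets.
\<close>

definition rat_sqrt_field :: "int \<Rightarrow> complex set"
  where "rat_sqrt_field d = generate_field complex_ring {csqrt (of_int d)}"

definition ring_of_integers :: "complex set \<Rightarrow> complex set"
  where "ring_of_integers K = {x \<in> K. algebraic_int x}"

definition fractional_ideals :: "complex set \<Rightarrow> complex set set"
  where "fractional_ideals K =
    {I. I \<subseteq> K \<and> I \<noteq> {0} \<and> subgroup I (add_monoid complex_ring) \<and>
        (\<forall>a\<in>ring_of_integers K. \<forall>x\<in>I. a * x \<in> I) \<and>
        (\<exists>c\<in>ring_of_integers K. c \<noteq> 0 \<and> (\<forall>x\<in>I. c * x \<in> ring_of_integers K))}"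

definition principal_fractional_ideals :: "complex set \<Rightarrow> complex set set"
  where "principal_fractional_ideals K =
    {(\<lambda>x. a * x) ` ring_of_integers K | a. a \<in> K \<and> a \<noteq> 0}"

text \<open>
  The set \<^term>\<open>ideal_prod complex_ring I J\<close> consists of the nonempty finite sums of products of an
  element of \<open>I\<close> and an element of \<open>J\<close>, so it is the usual product also for fractional ideals.
\<close>

definition fractional_ideal_group :: "complex set \<Rightarrow> complex set monoid"
  where "fractional_ideal_group K =
    \<lparr>carrier = fractional_ideals K,
     monoid.mult = ideal_prod complex_ring,
     one = ring_of_integers K\<rparr>"

definition ideal_class_group :: "complex set \<Rightarrow> complex set set monoid"
  where "ideal_class_group K = fractional_ideal_group K Mod principal_fractional_ideals K"

text \<open>
  \<^const>\<open>Coset.order\<close> is the cardinality of the carrier. It would be 0 for an infinite group, but the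
  ideal class group of a number field is finite.
\<close>

definition class_number :: "complex set \<Rightarrow> nat"
  where "class_number K = Coset.order (ideal_class_group K)"

end

theory Submission
  imports Defs
begin

text \<open>
  Let \<open>\<theta>\<^sup>2 = 1 - 2 m ^ p\<close>. The element \<open>\<beta> = (1 + \<theta>)\<^sup>2 / 2 = 1 - m ^ p + \<theta>\<close> has norm \<open>m ^ (2 p)\<close> and is
  coprime to its conjugate, so it generates the \<open>p\<close>-th power of the ideal \<open>A = (m\<^sup>2, \<beta>)\<close>. If \<open>A\<close> is
  not principal, its class has order \<open>p\<close>.

  If \<open>A\<close> is principal, there is an integer \<open>\<gamma>\<close> of norm \<open>2 m\<close> with
  \<open>\<gamma> ^ p = 2 ^ ((p - 1) / 2) (1 + \<theta>)\<close>, and up to sign its trace has to be 2, so that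
  \<open>\<gamma> = 1 + \<surd>(1 - 2 m)\<close> depends on \<open>m\<close> only. The trace of \<open>\<gamma> ^ p\<close> is then a fixed binary recurrence in \<open>p\<close>
  whose normalised value is 1 or -1. A 2-adic argument shows that this happens for finitely many \<open>p\<close>.

  If infinitely many \<open>p\<close> gave the same field, two exponents \<open>p\<close> and \<open>q\<close> outside the exceptional set would give
  the same ideal \<open>A\<close>. Its class would have order dividing both \<open>p\<close> and \<open>q\<close>, so \<open>A\<close> would be principal.
\<close>

text \<open>The integer 1 - 2 m^p may have square factors, so no explicit basis of the ring of
  integers is at hand. Integrality is therefore read off from trace and norm, with complex
  conjugation as the Galois automorphism because the field is imaginary. The passage to \<beta> gets
  rid of the prime above 2: \<alpha> = 1 + \<theta> has norm 2 m^p, so its ideal is not a p-th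
  power, while \<alpha>^2 / 2 has odd norm. The 2 returns in \<gamma>, whose square is twice a p-th
  root of \<beta>. The special form of the radicand matters there: \<alpha> has trace 2, so the
  trace of \<gamma> divides a power of 2, which together with parity leaves only 2 and -2. In the
  2-adic part the obstacle is that s = (m - 1) / 2 may contain any power of 2. The expansion is
  therefore kept in terms of s itself, and the main term and the error are compared after both have
  been divided by the same power of s.\<close>

section \<open>A binary recurrence\<close>

text \<open>
  For the roots \<open>\<gamma>, \<gamma>'\<close> of \<open>X\<^sup>2 - 2 X + 2 (1 + 2 s)\<close> the sum \<open>\<gamma> ^ (2 k + 1) + \<gamma>' ^ (2 k + 1)\<close>
  equals \<open>2 ^ (k + 1) * half_trace s k\<close>, see \<open>half_trace_power_sum\<close>.
\<close>

fun half_trace :: "int \<Rightarrow> nat \<Rightarrow> int" where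
  "half_trace s 0 = 1"
| "half_trace s (Suc 0) = - 1 - 6 * s"
| "half_trace s (Suc (Suc k)) = - 4 * s * half_trace s (Suc k) - (1 + 2 * s)\<^sup>2 * half_trace s k"

text \<open>The inductions below pass from a sequence to combinations of its shifts, so they speak
  about all solutions of the recurrence and not about \<open>half_trace\<close> alone.\<close>

definition linrec :: "int \<Rightarrow> int \<Rightarrow> (nat \<Rightarrow> int) \<Rightarrow> bool" where
  "linrec c d f \<longleftrightarrow> (\<forall>k. f (Suc (Suc k)) = c * f (Suc k) + d * f k)"

text \<open>
  With \<open>E\<close> the shift operator, the assumption \<open>four\<close> reads \<open>E ^ 4 = 1 + 2 H (a + b E)\<close>. Iterated squaring
  gives \<open>E ^ (4 * 2 ^ e) = 1 + 2 H 2 ^ e (a + b E + H R)\<close> for some polynomial \<open>R\<close> in \<open>E\<close>.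
\<close>

lemma linrec_shift_pow2:
  assumes "linrec c d f"
    and four: "\<And>f k. linrec c d f \<Longrightarrow> f (k + 4) = f k + 2 * H * (a * f k + b * f (Suc k))"
  shows "\<exists>g. linrec c d g \<and>
    (\<forall>k. f (k + 4 * 2 ^ e) = f k + 2 * H * 2 ^ e * (a * f k + b * f (Suc k) + H * g k))"
  using assms(1)
proof (induction e arbitrary: f)
  case 0
  show ?case
    by (rule exI[of _ "\<lambda>_. 0"]) (use four[OF 0] in \<open>simp add: linrec_def\<close>)
next
  case (Suc e)
  obtain g where g: "linrec c d g"
    and fg: "\<And>k. f (k + 4 * 2 ^ e) = f k + 2 * H * 2 ^ e * (a * f k + b * f (Suc k) + H * g k)"
    using Suc.IH[OF Suc.prems] by blast
  define u where "u = (\<lambda>k. a * f k + b * f (Suc k) + H * g k)"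
  have u: "linrec c d u"
    using Suc.prems g by (simp add: u_def linrec_def algebra_simps)
  obtain g' where g': "linrec c d g'"
    and ug: "\<And>k. u (k + 4 * 2 ^ e) = u k + 2 * H * 2 ^ e * (a * u k + b * u (Suc k) + H * g' k)"
    using Suc.IH[OF u] by blast
  \<comment> \<open>Squaring 1 + 2 H 2^e X doubles the linear term and adds (2 H 2^e)^2 X^2, which
    is 2 H 2^(e+1) times H 2^e X^2. The square thus goes into the remainder, with a factor H to
    spare.\<close>
  define w where "w = (\<lambda>k. g k + 2 ^ e * (a * u k + b * u (Suc k) + H * g' k))"
  have "linrec c d w"
    using u g g' by (simp add: w_def linrec_def algebra_simps)
  moreover have "f (k + 4 * 2 ^ Suc e)
      = f k + 2 * H * 2 ^ Suc e * (a * f k + b * f (Suc k) + H * w k)" for k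
  proof -
    have "f (k + 4 * 2 ^ Suc e) = f ((k + 4 * 2 ^ e) + 4 * 2 ^ e)"
      by (simp add: algebra_simps)
    also have "\<dots> = f (k + 4 * 2 ^ e) + 2 * H * 2 ^ e * u (k + 4 * 2 ^ e)"
      unfolding u_def by (rule fg)
    also have "\<dots> = f k + 2 * H * 2 ^ e * u k
        + 2 * H * 2 ^ e * (u k + 2 * H * 2 ^ e * (a * u k + b * u (Suc k) + H * g' k))"
      unfolding ug[of k] using fg[of k] by (simp add: u_def)
    also have "\<dots> = f k + 2 * H * 2 ^ Suc e * (u k + H * (2 ^ e * (a * u k + b * u (Suc k) + H * g' k)))"
      by (simp add: algebra_simps)
    finally show ?thesis by (simp add: w_def u_def algebra_simps)
  qed
  ultimately show ?case by blast
qed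

text \<open>Each of the j shifts contributes the same linear term up to a multiple of H, because
  shifting changes f, and with it a f + b E f, only by multiples of H. Hence the factor j in
  front.\<close>

lemma linrec_shift:
  assumes "linrec c d f"
    and four: "\<And>f k. linrec c d f \<Longrightarrow> f (k + 4) = f k + 2 * H * (a * f k + b * f (Suc k))"
  shows "\<exists>r. f (k + 4 * 2 ^ e * j) = f k + 2 * H * 2 ^ e * (int j * (a * f k + b * f (Suc k)) + H * r)"
proof -
  obtain g where fg: "\<And>k. f (k + 4 * 2 ^ e) = f k + 2 * H * 2 ^ e * (a * f k + b * f (Suc k) + H * g k)"
    using linrec_shift_pow2[OF assms] by blast
  define u where "u = (\<lambda>k. a * f k + b * f (Suc k))"
  have "\<exists>r. f (k + 4 * 2 ^ e * j) = f k + 2 * H * 2 ^ e * (int j * u k + H * r)" for k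
  proof (induction j arbitrary: k)
    case (Suc j)
    let ?k = "k + 4 * 2 ^ e"
    obtain r where r: "f (?k + 4 * 2 ^ e * j) = f ?k + 2 * H * 2 ^ e * (int j * u ?k + H * r)"
      using Suc by blast
    define v where "v = (\<lambda>k. 2 * 2 ^ e * (a * f k + b * f (Suc k) + H * g k))"
    have v: "f (k + 4 * 2 ^ e) = f k + H * v k" for k
      unfolding v_def fg[of k] by (simp add: algebra_simps)
    have "u ?k = u k + H * (a * v k + b * v (Suc k))"
      using v[of k] v[of "Suc k"] by (simp add: u_def algebra_simps)
    moreover have "f ?k = f k + 2 * H * 2 ^ e * (u k + H * g k)"
      unfolding u_def by (rule fg)
    ultimately have "f (?k + 4 * 2 ^ e * j) =
        f k + 2 * H * 2 ^ e * (int (Suc j) * u k + H * (r + g k + int j * (a * v k + b * v (Suc k))))"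
      unfolding r by (simp add: algebra_simps)
    moreover have "?k + 4 * 2 ^ e * j = k + 4 * 2 ^ e * Suc j"
      by simp
    ultimately show ?case by metis
  qed (auto intro: exI[of _ 0])
  then show ?thesis unfolding u_def by blast
qed

lemma ex_odd_times_pow2:
  assumes "t \<noteq> (0::nat)"
  shows "\<exists>e j. odd j \<and> t = 2 ^ e * j"
  using assms
proof (induction t rule: less_induct)
  case (less t)
  show ?case
  proof (cases "odd t")
    case True
    then show ?thesis by (intro exI[of _ 0] exI[of _ t]) simp
  next
    case False
    then obtain u where "t = 2 * u" by blast
    with less.prems have "u < t" "u \<noteq> 0" by simp_all
    with less.IH[of u] obtain e j where "odd j" "u = 2 ^ e * j" by blast
    with \<open>t = 2 * u\<close> show ?thesis by (intro exI[of _ "Suc e"] exI[of _ j]) simp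
  qed
qed

section \<open>The 2-adic behaviour of \<open>half_trace\<close>\<close>

context
  fixes s :: int
  assumes s: "s \<ge> 1"
begin

private abbreviation "W \<equiv> half_trace s"
text \<open>These are the coefficients in E^4 = 1 + 8 s (\<xi> + \<eta> E), obtained by reducing E^4
  with E^2 = - 4 s E - (1 + 2 s)^2. The general shift lemma is applied with H = 4 s.\<close>

private abbreviation "\<xi> \<equiv> 1 + s - 4 * s ^ 2 - 6 * s ^ 3"
private abbreviation "\<eta> \<equiv> 1 + 4 * s - 4 * s ^ 2"

lemma half_trace_four:
  assumes "linrec (- 4 * s) (- ((1 + 2 * s)\<^sup>2)) f"
  shows "f (k + 4) = f k + 2 * (4 * s) * (\<xi> * f k + \<eta> * f (Suc k))"
proof -
  have rec: "f (Suc (Suc k)) = (- 4 * s) * f (Suc k) + (- ((1 + 2 * s)\<^sup>2)) * f k" for k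
    using assms by (simp add: linrec_def)
  have "f (k + 4) = f (Suc (Suc (Suc (Suc k))))"
    by (simp add: eval_nat_numeral)
  also have "\<dots> = (- 4 * s) * f (Suc (Suc (Suc k))) + (- ((1 + 2 * s)\<^sup>2)) * f (Suc (Suc k))"
    by (rule rec)
  also have "\<dots> = f k + 2 * (4 * s) * (\<xi> * f k + \<eta> * f (Suc k))"
    unfolding rec[of "Suc k"] rec[of k] by (simp add: algebra_simps power_numeral_even power_numeral_odd)
  finally show ?thesis .
qed

lemma half_trace_shift:
  "\<exists>r. W (k + 4 * 2 ^ e * j) = W k + 8 * s * 2 ^ e * (int j * (\<xi> * W k + \<eta> * W (Suc k)) + 4 * s * r)"
proof -
  have "linrec (- 4 * s) (- ((1 + 2 * s)\<^sup>2)) W"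
    by (simp add: linrec_def)
  from linrec_shift[OF this half_trace_four, of k e j] show ?thesis
    by simp
qed

lemma half_trace_mod: "\<exists>r. W (k + 4 * j) = W k + 8 * s * r"
  using half_trace_shift[of k 0 j] by auto

text \<open>
  The 2-adic derivative of the sequence at an index where it is a unit has the same valuation as \<open>s\<close>.
  Hence in \<open>half_trace_shift\<close> the linear term dominates, and each of the values 1 and -1 occurs at
  most once in every residue class mod 4.
\<close>

lemma half_trace_unit_derivative:
  assumes "\<bar>W k\<bar> = 1"
  shows "\<exists>z. odd z \<and> \<xi> * W k + \<eta> * W (Suc k) = s * z"
proof -
  \<comment> \<open>Replacing k by its residue i changes the combination by a multiple of 8 s, so
    the parity of its quotient by s can be computed at i. At i = 0 and i = 2 that quotient is odd
    for every s; at i = 1 and i = 3 the hypothesis on W k is needed.\<close>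
  define i where "i = k mod 4"
  have k: "k = i + 4 * (k div 4)" unfolding i_def by (rule mod_mult_div_eq[symmetric])
  obtain r where r: "W k = W i + 8 * s * r"
    using half_trace_mod[of i "k div 4"] k by metis
  obtain r' where r': "W (Suc k) = W (Suc i) + 8 * s * r'"
    using half_trace_mod[of "Suc i" "k div 4"] k by (metis add_Suc)
  define c where "c = 4 * (\<xi> * r + \<eta> * r')"
  have eq: "\<xi> * W k + \<eta> * W (Suc k) = \<xi> * W i + \<eta> * W (Suc i) + s * (2 * c)"
    unfolding r r' c_def by (simp add: algebra_simps)
  have W2: "W 2 = - 1 + 20 * s ^ 2"
    by (simp add: numeral_2_eq_2 power2_eq_square algebra_simps)
  have W3: "W 3 = 1 + 2 * s * (7 + 14 * s - 28 * s ^ 2)"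
    by (simp add: numeral_3_eq_3 power2_eq_square power3_eq_cube algebra_simps)
  have "i < 4" by (simp add: i_def)
  then consider "i = 0" | "i = 1" | "i = 2" | "i = 3" by linarith
  then have "\<exists>z. odd z \<and> \<xi> * W i + \<eta> * W (Suc i) = s * z"
  proof cases
    case 1
    have "\<xi> * W i + \<eta> * W (Suc i) = s * (- 9 + 2 * (- 12 * s + 9 * s ^ 2))"
    proof -
      have "i = 0" "Suc i = Suc 0" using 1 by auto
      then have W01: "W i = 1" "W (Suc i) = - 1 - 6 * s" by simp_all
      show ?thesis unfolding W01 by (simp add: algebra_simps power_numeral_even power_numeral_odd)
    qed
    then show ?thesis by (intro exI[of _ "- 9 + 2 * (- 12 * s + 9 * s ^ 2)"]) simp
  next
    \<comment> \<open>Here W k = -1 is impossible because 3 - 4 r is odd, and W k = 1 forces s = 1.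
      Then \<xi> = -8, \<eta> = 1, and the value is (-8) (-7) + 19 = 75.\<close>
    case 2
    have "W k = - 1 - s * (2 * (3 - 4 * r))"
      using r 2 by (simp add: algebra_simps)
    moreover have "s * (2 * (3 - 4 * r)) \<noteq> 0"
      using s by simp presburger
    ultimately have "s * (2 * (3 - 4 * r)) = - 2"
      using assms by linarith
    then have "s * (4 * r - 3) = 1"
      by (simp add: algebra_simps)
    then have "s = 1"
      using s by (simp add: zmult_eq_1_iff)
    moreover have "W i = W 1" "W (Suc i) = W 2"
      using 2 by (simp_all add: numeral_2_eq_2)
    ultimately show ?thesis
      using W2 by (intro exI[of _ 75]) simp
  next
    case 3
    have "\<xi> * W i + \<eta> * W (Suc i) = s * (17 + 2 * (52 * s + 13 * s ^ 2 - 208 * s ^ 3 + 52 * s ^ 4))"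
    proof -
      have "i = 2" "Suc i = 3" using 3 by auto
      then have W23: "W i = W 2" "W (Suc i) = W 3" by (simp_all only:)
      show ?thesis unfolding W23 W2 W3 by (simp add: algebra_simps power_numeral_even power_numeral_odd)
    qed
    then show ?thesis
      by (intro exI[of _ "17 + 2 * (52 * s + 13 * s ^ 2 - 208 * s ^ 3 + 52 * s ^ 4)"]) simp
  next
    \<comment> \<open>This class contains no unit value: W k = 1 fails because v is odd, and W k =
      -1 forces s = 1 and v = -1, which is impossible modulo 4.\<close>
    case 4
    define v where "v = 7 + 2 * (7 * s - 14 * s ^ 2 + 2 * r)"
    have "W k = 1 + 2 * (s * v)"
      using r 4 W3 by (simp add: v_def algebra_simps)
    moreover have "odd v"
      by (simp add: v_def)
    then have "s * v \<noteq> 0"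
      using s by auto
    ultimately have "s * v = - 1"
      using assms by linarith
    then have "s * (- v) = 1"
      by simp
    then have "s = 1 \<and> - v = 1"
      using s unfolding zmult_eq_1_iff by linarith
    then have "s = 1" "v = - 1"
      by simp_all
    then have "7 + 2 * (7 - 14 + 2 * r) = - 1"
      by (auto simp: v_def)
    then have False
      by presburger
    then show ?thesis ..
  qed
  then obtain z where "odd z" "\<xi> * W i + \<eta> * W (Suc i) = s * z" by blast
  then have "odd (z + 2 * c) \<and> \<xi> * W k + \<eta> * W (Suc k) = s * (z + 2 * c)"
    using eq by (simp add: distrib_left)
  then show ?thesis ..
qed

lemma finite_half_trace_unit: "finite {k. \<bar>W k\<bar> = 1}"
proof (rule finite_imageD)
  let ?S = "{k. \<bar>W k\<bar> = 1}"
  have "(\<lambda>k. (k mod 4, W k)) ` ?S \<subseteq> {..<4} \<times> {- 1, 1}"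
  proof (rule image_subsetI)
    fix k assume "k \<in> ?S"
    then have "W k = - 1 \<or> W k = 1" by (auto simp only: mem_Collect_eq)
    then show "(k mod 4, W k) \<in> {..<4} \<times> {- 1, 1}" by simp
  qed
  then show "finite ((\<lambda>k. (k mod 4, W k)) ` ?S)"
    by (rule finite_subset) simp
  have *: "k = l" if kl: "k \<le> l" "\<bar>W k\<bar> = 1" "k mod 4 = l mod 4" "W k = W l" for k l
  proof (rule ccontr)
    assume "k \<noteq> l"
    have "4 dvd l - k"
      using kl(1,3) by (metis mod_eq_dvd_iff_nat)
    then obtain t where "l - k = 4 * t"
      by (rule dvdE)
    then have t: "l = k + 4 * t"
      using kl(1) by linarith
    have "t \<noteq> 0"
      using \<open>k \<noteq> l\<close> unfolding t by (cases "t = 0") simp_all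
    then obtain e j where ej: "odd j" "t = 2 ^ e * j"
      using ex_odd_times_pow2[OF \<open>t \<noteq> 0\<close>] by blast
    obtain z where z: "odd z" "\<xi> * W k + \<eta> * W (Suc k) = s * z"
      using half_trace_unit_derivative[OF kl(2)] by blast
    \<comment> \<open>The linear term j s z and the error 4 s r share the factor s. Once it is
      cancelled, parity decides: j z is odd and 4 r is even.\<close>
    obtain r where "W (k + 4 * 2 ^ e * j) = W k + 8 * s * 2 ^ e * (int j * (s * z) + 4 * s * r)"
      using half_trace_shift[of k e j] unfolding z(2) ..
    moreover have "W (k + 4 * 2 ^ e * j) = W k"
      using kl(4) t ej(2) by (simp add: mult.assoc)
    ultimately have "8 * s * 2 ^ e * (int j * (s * z) + 4 * s * r) = 0"
      by linarith
    then have "(8 * s * 2 ^ e * s) * (int j * z + 4 * r) = 0"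
      by (simp only: distrib_left mult_ac)
    moreover have "8 * s * 2 ^ e * s \<noteq> 0"
      using s by simp
    ultimately have "int j * z + 4 * r = 0"
      by (metis mult_eq_0_iff)
    then have "int j * z = 2 * (- 2 * r)"
      by linarith
    then have "even (int j * z)"
      by (rule dvdI)
    then show False
      using ej(1) z(1) by simp
  qed
  show "inj_on (\<lambda>k. (k mod 4, W k)) ?S"
  proof (rule inj_onI)
    fix k l
    assume "k \<in> ?S" "l \<in> ?S" "(k mod 4, W k) = (l mod 4, W l)"
    then have "\<bar>W k\<bar> = 1" "\<bar>W l\<bar> = 1" "k mod 4 = l mod 4" "W k = W l"
      by simp_all
    then show "k = l"
      using *[of k l] *[of l k] by (metis nat_le_linear)
  qed
qed

end

section \<open>Integers of quadratic fields\<close>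

text \<open>If r = a / b in lowest terms, then b^k divides c for every k, so b = 1.\<close>

lemma rat_power_denominators_bounded:
  fixes r :: "'a::field_char_0"
  assumes "r \<in> \<rat>" "c \<noteq> 0" "\<And>k. of_int c * r ^ k \<in> \<int>"
  shows "r \<in> \<int>"
proof -
  obtain a b where ab: "b > 0" "Rings.coprime a b" "r = of_int a / of_int b"
    using assms(1) by (auto elim: Rats_cases')
  have dvd: "b ^ k dvd c" for k
  proof -
    obtain z where "of_int c * r ^ k = of_int z"
      using assms(3)[of k] by (elim Ints_cases)
    then have "of_int (c * a ^ k) = (of_int (z * b ^ k) :: 'a)"
      using ab by (simp add: field_simps power_divide)
    then have "c * a ^ k = z * b ^ k"
      by (simp only: of_int_eq_iff)
    then have "b ^ k dvd c * a ^ k"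
      by simp
    moreover have "Rings.coprime (b ^ k) (a ^ k)"
      using ab(2) by (simp add: coprime_commute)
    ultimately show ?thesis
      by (simp add: coprime_dvd_mult_left_iff)
  qed
  have "b = 1"
  proof (rule ccontr)
    assume "b \<noteq> 1"
    with ab(1) have "b \<ge> 2" by simp
    \<comment> \<open>This exponent is large enough because 2^k > k.\<close>
    define k where "k = nat \<bar>c\<bar>"
    have "int k < 2 ^ k"
      by (metis of_nat_less_two_power)
    also have "(2::int) ^ k \<le> b ^ k"
      using \<open>b \<ge> 2\<close> by (simp add: power_mono)
    also have "b ^ k \<le> \<bar>c\<bar>"
      using dvd_imp_le_int[OF assms(2) dvd[of k]] ab(1) by simp
    finally show False by (simp add: k_def)
  qed
  then show ?thesis by (simp add: ab(3))
qed

text \<open>The axioms describe the rational field and the imaginary quadratic fields: every x is a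
  root of X^2 - (x + cnj x) X + x * cnj x with rational coefficients. Generator and discriminant
  stay out of the axioms, so several square roots can be used in one field.\<close>

locale quadratic_subfield =
  fixes K :: "complex set"
  assumes one_mem: "1 \<in> K"
    and add_mem: "x \<in> K \<Longrightarrow> y \<in> K \<Longrightarrow> x + y \<in> K"
    and mult_mem: "x \<in> K \<Longrightarrow> y \<in> K \<Longrightarrow> x * y \<in> K"
    and uminus_mem: "x \<in> K \<Longrightarrow> - x \<in> K"
    and inverse_mem: "x \<in> K \<Longrightarrow> inverse x \<in> K"
    and cnj_mem: "x \<in> K \<Longrightarrow> cnj x \<in> K"
    and trace_rat: "x \<in> K \<Longrightarrow> x + cnj x \<in> \<rat>"
    and norm_rat: "x \<in> K \<Longrightarrow> x * cnj x \<in> \<rat>"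
begin

abbreviation "\<O> \<equiv> ring_of_integers K"

lemma diff_mem: "x \<in> K \<Longrightarrow> y \<in> K \<Longrightarrow> x - y \<in> K"
  using add_mem[OF _ uminus_mem, of x y] by simp

lemma divide_mem: "x \<in> K \<Longrightarrow> y \<in> K \<Longrightarrow> x / y \<in> K"
  using mult_mem[OF _ inverse_mem, of x y] by (simp add: divide_inverse)

lemma zero_mem: "0 \<in> K"
  using diff_mem[OF one_mem one_mem] by simp

lemma power_mem: "x \<in> K \<Longrightarrow> x ^ k \<in> K"
  by (induction k) (auto intro: one_mem mult_mem)

lemma of_nat_mem: "of_nat k \<in> K"
  by (induction k) (auto intro: zero_mem one_mem add_mem)

lemma of_int_mem: "of_int k \<in> K"
  by (cases k rule: int_cases2) (auto intro: of_nat_mem uminus_mem)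

lemma rat_mem: "x \<in> \<rat> \<Longrightarrow> x \<in> K"
  by (elim Rats_cases') (auto intro: divide_mem of_int_mem)

text \<open>The conclusion is phrased by trace and norm because \<open>integers_iff\<close>, which
  turns this into integrality, is itself derived from it.\<close>

lemma clear_denominator:
  assumes "x \<in> K"
  shows "\<exists>e::int. e \<noteq> 0 \<and> of_int e * x \<in> K \<and> of_int e * x + cnj (of_int e * x) \<in> \<int> \<and>
    of_int e * x * cnj (of_int e * x) \<in> \<int>"
proof -
  obtain a b where 1: "b > 0" "x + cnj x = of_int a / of_int b"
    using trace_rat[OF assms] by (elim Rats_cases') auto
  obtain a' b' where 2: "b' > 0" "x * cnj x = of_int a' / of_int b'"
    using norm_rat[OF assms] by (elim Rats_cases') auto
  let ?y = "of_int (b * b') * x"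
  have "?y + cnj ?y = of_int (b * b') * (x + cnj x)"
    by (simp add: algebra_simps)
  also have "\<dots> = of_int (a * b')"
    unfolding 1 using 1(1) by simp
  finally have "?y + cnj ?y \<in> \<int>" by simp
  moreover have "?y * cnj ?y = of_int (b * b') ^ 2 * (x * cnj x)"
    by (simp add: power2_eq_square)
  then have "?y * cnj ?y = of_int (b ^ 2 * b' * a')"
    unfolding 2 using 2(1) by (simp add: power2_eq_square)
  then have "?y * cnj ?y \<in> \<int>" by (metis Ints_of_int)
  moreover have "b * b' \<noteq> 0" using 1 2 by simp
  ultimately show ?thesis
    using mult_mem[OF of_int_mem assms] by blast
qed

text \<open>
  All powers of \<open>x\<close> and of \<open>1 + x\<close> have a common denominator over the order \<open>\<int> + \<int> y\<close>. So do the
  powers of their norms, which are therefore integers.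
\<close>

lemma algebraic_int_denominators:
  assumes "x \<in> K" "algebraic_int x"
  obtains c t n :: int and y where "c \<noteq> 0" "y + cnj y = of_int t" "y * cnj y = of_int n"
    "\<And>k. \<exists>a b. of_int c * x ^ k = of_int a + of_int b * y"
    "\<And>k. \<exists>a b. of_int c * (1 + x) ^ k = of_int a + of_int b * y"
proof -
  obtain e where e: "e \<noteq> 0" "of_int e * x \<in> K" "of_int e * x + cnj (of_int e * x) \<in> \<int>"
    "of_int e * x * cnj (of_int e * x) \<in> \<int>"
    using clear_denominator[OF assms(1)] by blast
  define y where "y = of_int e * x"
  obtain t where t: "y + cnj y = of_int t"
    using e(3) unfolding y_def by (elim Ints_cases)
  obtain n where n: "y * cnj y = of_int n"
    using e(4) unfolding y_def by (elim Ints_cases)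
  have "y * y = y * (y + cnj y) - y * cnj y"
    by (simp add: algebra_simps)
  then have yy: "y * y = of_int t * y - of_int n"
    unfolding t n by simp
  define R where "R = {of_int a + of_int b * y | a b. True}"
  have RI: "of_int a + of_int b * y \<in> R" for a b
    by (auto simp: R_def)
  have R_add: "u + v \<in> R" if uv: "u \<in> R" "v \<in> R" for u v
  proof -
    obtain a b a' b' where "u = of_int a + of_int b * y" "v = of_int a' + of_int b' * y"
      using uv by (auto simp: R_def)
    then have "u + v = of_int (a + a') + of_int (b + b') * y"
      by (simp add: algebra_simps)
    then show ?thesis using RI by metis
  qed
  have R_mult: "u * v \<in> R" if uv: "u \<in> R" "v \<in> R" for u v
  proof -
    obtain a b a' b' where ab: "u = of_int a + of_int b * y" "v = of_int a' + of_int b' * y"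
      using uv by (auto simp: R_def)
    have "u * v = of_int a * of_int a' + (of_int a * of_int b' + of_int a' * of_int b) * y
        + of_int b * of_int b' * (y * y)"
      unfolding ab by (simp add: algebra_simps)
    also have "\<dots> = of_int (a * a' - b * b' * n) + of_int (a * b' + a' * b + b * b' * t) * y"
      unfolding yy by (simp add: algebra_simps)
    finally show ?thesis using RI by metis
  qed
  have R_int: "of_int a \<in> R" for a
    using RI[of a 0] by simp
  have y_pow: "y ^ k \<in> R" for k
    by (induction k) (use R_int[of 1] RI[of 0 1] in \<open>auto intro: R_mult\<close>)
  have R_sum: "(\<Sum>i\<in>A. f i) \<in> R" if "\<And>i. i \<in> A \<Longrightarrow> f i \<in> R" for A and f :: "nat \<Rightarrow> complex"
    using that by (induction A rule: infinite_finite_induct) (use R_int[of 0] in \<open>auto intro: R_add\<close>)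
  obtain p where p: "lead_coeff p = 1" "\<forall>i. coeff p i \<in> \<int>" "poly p x = 0"
    using assms(2) by (auto elim: algebraic_int.cases)
  define d where "d = degree p"
  have xd: "x ^ d = (\<Sum>i<d. - coeff p i * x ^ i)"
  proof -
    have "0 = (\<Sum>i\<le>d. coeff p i * x ^ i)"
      using p(3) by (simp add: poly_altdef d_def)
    also have "\<dots> = (\<Sum>i<d. coeff p i * x ^ i) + x ^ d"
      using p(1) by (simp add: lessThan_Suc_atMost[symmetric] d_def)
    finally show ?thesis by (simp add: sum_negf eq_neg_iff_add_eq_0 add.commute)
  qed
  \<comment> \<open>Since e x = y, the factor e^d clears x^k for k < d; higher powers reduce to
    these by the monic equation of degree d.\<close>
  define c where "c = e ^ d"
  have x_pow: "of_int c * x ^ k \<in> R" for k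
  proof (induction k rule: less_induct)
    case (less k)
    show ?case
    proof (cases "k < d")
      case True
      have "of_int c * x ^ k = of_int (e ^ (d - k)) * y ^ k"
        using True by (simp add: c_def y_def power_mult_distrib flip: power_add mult.assoc)
      then show ?thesis
        using R_mult[OF R_int y_pow] by metis
    next
      case False
      have "of_int c * x ^ k = of_int c * (x ^ (k - d) * x ^ d)"
        using False by (simp flip: power_add)
      also have "\<dots> = (\<Sum>i<d. - coeff p i * (of_int c * x ^ (k - d + i)))"
        unfolding xd by (simp add: sum_distrib_left power_add mult_ac sum_negf)
      also have "\<dots> \<in> R"
      proof (rule R_sum)
        fix i assume "i \<in> {..<d}"
        then have "of_int c * x ^ (k - d + i) \<in> R"
          using less False by simp
        moreover have "- coeff p i \<in> R"
          using p(2) R_int by (metis Ints_cases Ints_minus)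
        ultimately show "- coeff p i * (of_int c * x ^ (k - d + i)) \<in> R"
          by (rule R_mult[rotated])
      qed
      finally show ?thesis .
    qed
  qed
  \<comment> \<open>The extra factor x^j makes the induction work: one more factor 1 + x splits into
    the cases j and j + 1.\<close>
  have x1_pow: "of_int c * x ^ j * (1 + x) ^ k \<in> R" for j k
  proof (induction k arbitrary: j)
    case 0
    then show ?case using x_pow by simp
  next
    case (Suc k)
    have "of_int c * x ^ j * (1 + x) ^ Suc k
        = of_int c * x ^ j * (1 + x) ^ k + of_int c * x ^ Suc j * (1 + x) ^ k"
      by (simp add: algebra_simps)
    then show ?case using Suc R_add by metis
  qed
  show ?thesis
  proof (rule that[OF _ t n])
    show "c \<noteq> 0" using e(1) by (simp add: c_def)
    show "\<exists>a b. of_int c * x ^ k = of_int a + of_int b * y" for k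
      using x_pow[of k] by (simp add: R_def)
    show "\<exists>a b. of_int c * (1 + x) ^ k = of_int a + of_int b * y" for k
      using x1_pow[of 0 k] by (simp add: R_def)
  qed
qed

lemma norm_int_aux:
  assumes "z \<in> K" "c \<noteq> 0" "y + cnj y = of_int t" "y * cnj y = of_int n"
    and "\<And>k. \<exists>a b. of_int c * z ^ k = of_int a + of_int b * y"
  shows "z * cnj z \<in> \<int>"
proof (rule rat_power_denominators_bounded[OF norm_rat[OF assms(1)]])
  show "c * c \<noteq> 0" using assms by simp
  fix k
  obtain a b where ab: "of_int c * z ^ k = of_int a + of_int b * y"
    using assms(5) by blast
  have "of_int (c * c) * (z * cnj z) ^ k = (of_int c * z ^ k) * cnj (of_int c * z ^ k)"
    by (simp add: power_mult_distrib mult_ac)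
  also have "\<dots> = of_int (a * a) + of_int (a * b) * (y + cnj y) + of_int (b * b) * (y * cnj y)"
    unfolding ab by (simp add: algebra_simps)
  also have "\<dots> \<in> \<int>"
    unfolding assms(3,4) by simp
  finally show "of_int (c * c) * (z * cnj z) ^ k \<in> \<int>" .
qed

text \<open>The denominator argument yields only norms. The trace is recovered as N(1 + x) - N(x) -
  1, which is why the powers of 1 + x were treated along with those of x. Closure of the integers
  under sums and products is then deduced from this criterion.\<close>

lemma integers_iff: "x \<in> \<O> \<longleftrightarrow> x \<in> K \<and> x + cnj x \<in> \<int> \<and> x * cnj x \<in> \<int>"
proof (intro iffI conjI)
  assume "x \<in> \<O>"
  then have x: "x \<in> K" "algebraic_int x"
    by (auto simp: ring_of_integers_def)
  then show "x \<in> K" by simp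
  obtain c t n :: int and y where *: "c \<noteq> 0" "y + cnj y = of_int t" "y * cnj y = of_int n"
    "\<And>k. \<exists>a b. of_int c * x ^ k = of_int a + of_int b * y"
    "\<And>k. \<exists>a b. of_int c * (1 + x) ^ k = of_int a + of_int b * y"
    by (rule algebraic_int_denominators[OF x]) blast
  show 1: "x * cnj x \<in> \<int>"
    using norm_int_aux[OF x(1) *(1-4)] .
  have "(1 + x) * cnj (1 + x) \<in> \<int>"
    using norm_int_aux[OF add_mem[OF one_mem x(1)] *(1-3,5)] .
  moreover have "x + cnj x = (1 + x) * cnj (1 + x) - x * cnj x - 1"
    by (simp add: algebra_simps)
  ultimately show "x + cnj x \<in> \<int>"
    using 1 by simp
next
  assume x: "x \<in> K \<and> x + cnj x \<in> \<int> \<and> x * cnj x \<in> \<int>"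
  have "algebraic_int x"
  proof (rule algebraic_int.intros)
    let ?p = "[:x * cnj x, - (x + cnj x), 1:]"
    show "lead_coeff ?p = 1" by simp
    show "\<forall>i. coeff ?p i \<in> \<int>"
      using x by (auto simp: coeff_pCons split: nat.split simp del: minus_add_distrib)
    show "poly ?p x = 0" by (simp add: algebra_simps)
  qed
  then show "x \<in> \<O>" using x by (simp add: ring_of_integers_def)
qed

lemma integers_mem: "x \<in> \<O> \<Longrightarrow> x \<in> K"
  by (simp add: ring_of_integers_def)

lemma integers_cnj: "x \<in> \<O> \<Longrightarrow> cnj x \<in> \<O>"
  unfolding integers_iff by (simp add: cnj_mem add.commute mult.commute)

lemma integers_rat: "x \<in> \<O> \<Longrightarrow> x \<in> \<rat> \<Longrightarrow> x \<in> \<int>"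
  by (auto simp: ring_of_integers_def intro: rational_algebraic_int_is_int)

lemma integers_of_int: "of_int k \<in> \<O>"
  by (simp add: ring_of_integers_def of_int_mem)

lemma integers_uminus: "x \<in> \<O> \<Longrightarrow> - x \<in> \<O>"
  by (auto simp: ring_of_integers_def uminus_mem)

text \<open>
  The difference \<open>w\<close> of the traces of \<open>x * y\<close> and \<open>x * cnj y\<close> is rational and its square is the product
  of two discriminants, so it is an integer with the parity of the sum of these traces.
\<close>

lemma integers_trace_mult:
  assumes "x \<in> \<O>" "y \<in> \<O>"
  shows "x * y + cnj (x * y) \<in> \<int>"
proof -
  obtain T where T: "x + cnj x = of_int T"
    using assms by (auto simp: integers_iff elim: Ints_cases)
  obtain N where N: "x * cnj x = of_int N"
    using assms by (auto simp: integers_iff elim: Ints_cases)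
  obtain T' where T': "y + cnj y = of_int T'"
    using assms by (auto simp: integers_iff elim: Ints_cases)
  obtain N' where N': "y * cnj y = of_int N'"
    using assms by (auto simp: integers_iff elim: Ints_cases)
  define w where "w = (x - cnj x) * (y - cnj y)"
  have eq: "w = (x * y + cnj (x * y)) - (x * cnj y + cnj (x * cnj y))"
    by (simp add: w_def algebra_simps)
  have "x \<in> K" "y \<in> K" using assms integers_mem by auto
  then have "w \<in> \<rat>"
    unfolding eq by (intro Rats_diff trace_rat mult_mem cnj_mem)
  have "(x - cnj x) ^ 2 = (x + cnj x) ^ 2 - 4 * (x * cnj x)"
    by (simp add: power2_eq_square algebra_simps)
  then have 1: "(x - cnj x) ^ 2 = of_int (T ^ 2 - 4 * N)"
    unfolding T N by simp
  have "(y - cnj y) ^ 2 = (y + cnj y) ^ 2 - 4 * (y * cnj y)"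
    by (simp add: power2_eq_square algebra_simps)
  then have 2: "(y - cnj y) ^ 2 = of_int (T' ^ 2 - 4 * N')"
    unfolding T' N' by simp
  have w2: "w ^ 2 = of_int ((T ^ 2 - 4 * N) * (T' ^ 2 - 4 * N'))"
    unfolding w_def power_mult_distrib 1 2 by simp
  have "algebraic_int w"
    by (rule algebraic_int_root[where p = "monom 1 2" and y = "w ^ 2"])
       (auto simp: poly_monom degree_monom_eq w2 simp del: of_int_mult of_int_diff)
  with \<open>w \<in> \<rat>\<close> obtain W where W: "w = of_int W"
    using rational_algebraic_int_is_int by (metis Ints_cases)
  have "W ^ 2 = (T ^ 2 - 4 * N) * (T' ^ 2 - 4 * N')"
    using w2 unfolding W by (metis of_int_eq_iff of_int_power)
  then have "W ^ 2 = (T * T') ^ 2 - 2 * (2 * (N * T' ^ 2 + N' * T ^ 2 - 4 * N * N'))"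
    by (simp add: algebra_simps power2_eq_square)
  then have "even (W ^ 2) \<longleftrightarrow> even ((T * T') ^ 2)"
    by (simp only: even_diff even_add dvd_triv_left) simp
  then have "even (T * T' + W)"
    by simp
  then obtain k where k: "T * T' + W = 2 * k" by blast
  have "2 * (x * y + cnj (x * y)) = (x + cnj x) * (y + cnj y) + w"
    by (simp add: w_def algebra_simps)
  also have "\<dots> = of_int (T * T' + W)"
    unfolding T T' W by simp
  also have "\<dots> = 2 * of_int k"
    unfolding k by simp
  finally have "x * y + cnj (x * y) = of_int k"
    unfolding mult_cancel_left by simp
  then show ?thesis by simp
qed

lemma integers_mult:
  assumes "x \<in> \<O>" "y \<in> \<O>"
  shows "x * y \<in> \<O>"
proof -
  have "(x * cnj x) * (y * cnj y) \<in> \<int>"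
    by (rule Ints_mult) (use assms in \<open>simp_all add: integers_iff\<close>)
  then have "x * y * cnj (x * y) \<in> \<int>"
    by (simp add: mult_ac)
  then show ?thesis
    using assms integers_trace_mult[OF assms] by (simp add: integers_iff mult_mem)
qed

lemma integers_add:
  assumes "x \<in> \<O>" "y \<in> \<O>"
  shows "x + y \<in> \<O>"
proof -
  have "(x + y) * cnj (x + y) = x * cnj x + y * cnj y + (x * cnj y + cnj (x * cnj y))"
    by (simp add: algebra_simps)
  also have "\<dots> \<in> \<int>"
    by (intro Ints_add[OF Ints_add] integers_trace_mult[OF assms(1) integers_cnj[OF assms(2)]])
      (use assms in \<open>simp_all only: integers_iff\<close>)
  finally have "(x + y) * cnj (x + y) \<in> \<int>" .
  moreover have "(x + cnj x) + (y + cnj y) \<in> \<int>"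
    by (rule Ints_add) (use assms in \<open>simp_all add: integers_iff\<close>)
  then have "(x + y) + cnj (x + y) \<in> \<int>"
    by (simp add: algebra_simps)
  ultimately show ?thesis
    using assms by (simp add: integers_iff add_mem)
qed

lemma integers_power: "x \<in> \<O> \<Longrightarrow> x ^ k \<in> \<O>"
  by (induction k) (use integers_of_int[of 1] in \<open>auto intro: integers_mult\<close>)

end

section \<open>The ideal class group\<close>

lemma complex_ring_simps:
  "carrier complex_ring = UNIV" "x \<otimes>\<^bsub>complex_ring\<^esub> y = x * y" "x \<oplus>\<^bsub>complex_ring\<^esub> y = x + y"
  "\<one>\<^bsub>complex_ring\<^esub> = 1" "\<zero>\<^bsub>complex_ring\<^esub> = 0"
  by (simp_all add: ring_of_type_algebra_def)

lemma complex_ring_a_inv: "\<ominus>\<^bsub>complex_ring\<^esub> x = - x"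
proof -
  interpret R: field complex_ring by (rule field_from_type_algebra)
  show ?thesis
    by (rule R.minus_equality) (simp_all add: complex_ring_simps)
qed

lemma complex_ring_m_inv: "x \<noteq> 0 \<Longrightarrow> inv\<^bsub>complex_ring\<^esub> x = inverse x"
proof -
  interpret R: field complex_ring by (rule field_from_type_algebra)
  show "x \<noteq> 0 \<Longrightarrow> inv\<^bsub>complex_ring\<^esub> x = inverse x"
    by (rule R.comm_inv_char) (simp_all add: complex_ring_simps)
qed

lemma subgroup_add_complex_iff:
  "subgroup I (add_monoid complex_ring) \<longleftrightarrow>
    0 \<in> I \<and> (\<forall>x\<in>I. \<forall>y\<in>I. x + y \<in> I) \<and> (\<forall>x\<in>I. - x \<in> I)"
proof -
  have "inv\<^bsub>add_monoid complex_ring\<^esub> x = - x" for x :: complex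
    using complex_ring_a_inv by (simp add: a_inv_def)
  then show ?thesis
    unfolding subgroup_def by (auto simp only: complex_ring_simps monoid.simps partial_object.simps)
qed

abbreviation module_prod :: "complex set \<Rightarrow> complex set \<Rightarrow> complex set" (infixl "\<diamondop>" 70)
  where "I \<diamondop> J \<equiv> ideal_prod complex_ring I J"

lemma prod_memI: "i \<in> I \<Longrightarrow> j \<in> J \<Longrightarrow> i * j \<in> I \<diamondop> J"
  using ideal_prod.prod[of i I j J complex_ring] by (simp add: complex_ring_simps)

lemma prod_add: "a \<in> I \<diamondop> J \<Longrightarrow> b \<in> I \<diamondop> J \<Longrightarrow> a + b \<in> I \<diamondop> J"
  using ideal_prod.sum[of a complex_ring I J b] by (simp add: complex_ring_simps)

lemma prod_induct [consumes 1, case_names mult add]: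
  assumes "x \<in> I \<diamondop> J"
    and "\<And>i j. i \<in> I \<Longrightarrow> j \<in> J \<Longrightarrow> P (i * j)"
    and "\<And>a b. P a \<Longrightarrow> P b \<Longrightarrow> P (a + b)"
  shows "P x"
  using assms(1) by (induction rule: ideal_prod.induct) (auto simp: complex_ring_simps assms)

lemma prod_comm: "I \<diamondop> J = J \<diamondop> I"
proof -
  have "I \<diamondop> J \<subseteq> J \<diamondop> I" for I J
  proof
    fix x assume "x \<in> I \<diamondop> J"
    then show "x \<in> J \<diamondop> I"
      by (induction rule: prod_induct) (metis mult.commute prod_memI, rule prod_add)
  qed
  then show ?thesis by blast
qed

lemma prod_assoc: "(I \<diamondop> J) \<diamondop> L = I \<diamondop> (J \<diamondop> L)"
proof -
  have sub: "(I \<diamondop> J) \<diamondop> L \<subseteq> I \<diamondop> (J \<diamondop> L)" for I J L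
  proof
    fix x assume "x \<in> (I \<diamondop> J) \<diamondop> L"
    then show "x \<in> I \<diamondop> (J \<diamondop> L)"
    proof (induction rule: prod_induct)
      case (mult u l)
      from mult(1) show ?case
      proof (induction rule: prod_induct)
        case (mult i j)
        then have "i * (j * l) \<in> I \<diamondop> (J \<diamondop> L)"
          using \<open>l \<in> L\<close> by (intro prod_memI)
        then show ?case by (simp add: mult.assoc)
      qed (auto simp: distrib_right intro: prod_add)
    qed (rule prod_add)
  qed
  \<comment> \<open>The reverse inclusion is \<open>sub\<close> with I and L exchanged, by
    commutativity.\<close>
  have "I \<diamondop> (J \<diamondop> L) = (L \<diamondop> J) \<diamondop> I"
    by (simp add: prod_comm)
  also have "\<dots> \<subseteq> L \<diamondop> (J \<diamondop> I)" by (rule sub)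
  also have "\<dots> = (I \<diamondop> J) \<diamondop> L"
    by (simp add: prod_comm)
  finally show ?thesis using sub by blast
qed

section \<open>Fractional ideals, their inverses and the class group\<close>

context quadratic_subfield
begin

abbreviation "\<F> \<equiv> fractional_ideals K"
abbreviation "G \<equiv> fractional_ideal_group K"
abbreviation "PI \<equiv> principal_fractional_ideals K"
abbreviation principal where "principal a \<equiv> (\<lambda>x. a * x) ` \<O>"

lemma principal_fractional_ideals_iff: "I \<in> PI \<longleftrightarrow> (\<exists>a. a \<in> K \<and> a \<noteq> 0 \<and> I = principal a)"
  by (auto simp: principal_fractional_ideals_def)

lemma principal_add: "x \<in> principal a \<Longrightarrow> y \<in> principal a \<Longrightarrow> x + y \<in> principal a"
proof -
  assume "x \<in> principal a" "y \<in> principal a"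
  then obtain u v where uv: "u \<in> \<O>" "v \<in> \<O>" "x = a * u" "y = a * v" by blast
  have "a * (u + v) \<in> principal a"
    using integers_add[OF uv(1,2)] by blast
  then show ?thesis unfolding uv by (simp only: distrib_left)
qed

lemma fractional_idealI:
  assumes "I \<subseteq> K" "u \<in> I" "u \<noteq> 0" "\<And>x y. x \<in> I \<Longrightarrow> y \<in> I \<Longrightarrow> x + y \<in> I"
    "\<And>a x. a \<in> \<O> \<Longrightarrow> x \<in> I \<Longrightarrow> a * x \<in> I"
    "c \<in> \<O>" "c \<noteq> 0" "\<And>x. x \<in> I \<Longrightarrow> c * x \<in> \<O>"
  shows "I \<in> \<F>"
proof -
  have "0 \<in> I" "\<forall>x\<in>I. - x \<in> I"
    using assms(5)[OF integers_of_int[of 0] assms(2)] assms(5)[OF integers_of_int[of "-1"]] by simp_all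
  then show ?thesis
    unfolding fractional_ideals_def subgroup_add_complex_iff
    using assms(1,3,4,5) \<open>u \<in> I\<close> by (auto intro!: bexI[OF _ \<open>c \<in> \<O>\<close>] assms(7,8))
qed

lemma fractional_idealD:
  assumes "I \<in> \<F>"
  shows "I \<subseteq> K" "0 \<in> I" "\<And>x y. x \<in> I \<Longrightarrow> y \<in> I \<Longrightarrow> x + y \<in> I" "\<And>x. x \<in> I \<Longrightarrow> - x \<in> I"
    "\<And>a x. a \<in> \<O> \<Longrightarrow> x \<in> I \<Longrightarrow> a * x \<in> I" "\<exists>u\<in>I. u \<noteq> 0"
    "\<exists>c\<in>\<O>. c \<noteq> 0 \<and> (\<forall>x\<in>I. c * x \<in> \<O>)"
  using assms unfolding fractional_ideals_def subgroup_add_complex_iff by fast+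

lemma prod_fractional:
  assumes I: "I \<in> \<F>" and J: "J \<in> \<F>"
  shows "I \<diamondop> J \<in> \<F>"
proof -
  obtain u v where uv: "u \<in> I" "u \<noteq> 0" "v \<in> J" "v \<noteq> 0"
    using fractional_idealD(6)[OF I] fractional_idealD(6)[OF J] by blast
  obtain c where c: "c \<in> \<O>" "c \<noteq> 0" "\<And>x. x \<in> I \<Longrightarrow> c * x \<in> \<O>"
    using fractional_idealD(7)[OF I] by blast
  obtain d where d: "d \<in> \<O>" "d \<noteq> 0" "\<And>x. x \<in> J \<Longrightarrow> d * x \<in> \<O>"
    using fractional_idealD(7)[OF J] by blast
  show ?thesis
  proof (rule fractional_idealI[where u = "u * v" and c = "c * d"])
    show "I \<diamondop> J \<subseteq> K"
    proof
      fix x assume "x \<in> I \<diamondop> J"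
      then show "x \<in> K"
        by (induction rule: prod_induct)
          (use fractional_idealD(1)[OF I] fractional_idealD(1)[OF J] in \<open>auto intro: mult_mem add_mem\<close>)
    qed
    show "a * x \<in> I \<diamondop> J" if "a \<in> \<O>" "x \<in> I \<diamondop> J" for a x
      using that(2)
    proof (induction rule: prod_induct)
      case (mult i j)
      then have "(a * i) * j \<in> I \<diamondop> J"
        using that(1) by (intro prod_memI fractional_idealD(5)[OF I])
      then show ?case by (simp add: mult.assoc)
    qed (auto simp: distrib_left intro: prod_add)
    show "c * d * x \<in> \<O>" if "x \<in> I \<diamondop> J" for x
      using that
    proof (induction rule: prod_induct)
      case (mult i j)
      then have "(c * i) * (d * j) \<in> \<O>"
        by (intro integers_mult c d)
      then show ?case by (simp add: mult_ac)
    qed (auto simp: distrib_left intro: integers_add)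
  qed (use uv c d in \<open>auto intro: prod_memI prod_add integers_mult\<close>)
qed

lemma principal_fractional:
  assumes "a \<in> K" "a \<noteq> 0"
  shows "principal a \<in> \<F>"
proof -
  obtain e :: int where e: "e \<noteq> 0" "of_int e * a \<in> \<O>"
    using clear_denominator[OF assms(1)] unfolding integers_iff by blast
  show ?thesis
  proof (rule fractional_idealI[where u = a and c = "of_int e"])
    show "principal a \<subseteq> K"
      using assms by (auto intro: mult_mem integers_mem)
    show "a \<in> principal a"
      using integers_of_int[of 1] by (auto intro: rev_image_eqI)
    show "b * x \<in> principal a" if bx: "b \<in> \<O>" "x \<in> principal a" for b x
    proof -
      obtain u where u: "u \<in> \<O>" "x = a * u" using bx by blast
      have "a * (b * u) \<in> principal a"
        using integers_mult[OF bx(1) u(1)] by blast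
      then show ?thesis unfolding u(2) by (simp only: mult.left_commute)
    qed
    show "of_int e * x \<in> \<O>" if x: "x \<in> principal a" for x
    proof -
      obtain u where u: "u \<in> \<O>" "x = a * u" using x by blast
      show ?thesis
        using integers_mult[OF e(2) u(1)] unfolding u(2) by (simp only: mult.assoc)
    qed
  qed (use assms e integers_of_int principal_add in simp_all)
qed

lemma integers_prod:
  assumes "I \<in> \<F>"
  shows "\<O> \<diamondop> I = I"
proof
  show "\<O> \<diamondop> I \<subseteq> I"
  proof
    fix x assume "x \<in> \<O> \<diamondop> I"
    then show "x \<in> I"
      by (induction rule: prod_induct) (rule fractional_idealD[OF assms]; assumption)+
  qed
  show "I \<subseteq> \<O> \<diamondop> I"
  proof
    fix x assume "x \<in> I"
    then have "1 * x \<in> \<O> \<diamondop> I"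
      using integers_of_int[of 1] by (intro prod_memI) simp_all
    then show "x \<in> \<O> \<diamondop> I" by simp
  qed
qed

lemma principal_prod: "principal a \<diamondop> principal b = principal (a * b)"
proof
  show "principal a \<diamondop> principal b \<subseteq> principal (a * b)"
  proof
    fix x assume "x \<in> principal a \<diamondop> principal b"
    then show "x \<in> principal (a * b)"
    proof (induction rule: prod_induct)
      case (mult i j)
      then obtain u v where "i = a * u" "j = b * v" "u \<in> \<O>" "v \<in> \<O>" by blast
      then have "i * j = a * b * (u * v)" "u * v \<in> \<O>"
        by (simp_all add: integers_mult)
      then show ?case by blast
    qed (rule principal_add)
  qed
  show "principal (a * b) \<subseteq> principal a \<diamondop> principal b"
  proof
    fix x assume "x \<in> principal (a * b)"
    then obtain u where u: "u \<in> \<O>" "x = (a * b) * u" by blast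
    have "(a * 1) * (b * u) \<in> principal a \<diamondop> principal b"
      using u(1) integers_of_int[of 1] by (intro prod_memI imageI) simp_all
    then show "x \<in> principal a \<diamondop> principal b"
      using u(2) by (simp add: mult.assoc)
  qed
qed

text \<open>
  The ideal \<open>cnj ` I \<diamondop> I\<close> is generated by the positive generator \<open>g\<close> of the group of its rational
  elements: for \<open>a, b \<in> I\<close> the quotient \<open>cnj a * b / g\<close> has integral trace and norm.
\<close>

lemma inverse_fractional:
  assumes I: "I \<in> \<F>"
  shows "\<exists>J\<in>\<F>. J \<diamondop> I = \<O>"
proof -
  define P where "P = cnj ` I \<diamondop> I"
  note ID = fractional_idealD[OF I]
  have "cnj ` I \<in> \<F>"
  proof -
    obtain u where u: "u \<in> I" "u \<noteq> 0" using ID(6) by blast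
    obtain c where c: "c \<in> \<O>" "c \<noteq> 0" "\<And>x. x \<in> I \<Longrightarrow> c * x \<in> \<O>" using ID(7) by blast
    show ?thesis
    proof (rule fractional_idealI[where u = "cnj u" and c = "cnj c"])
      show "cnj ` I \<subseteq> K" using ID(1) cnj_mem by auto
      show "x + y \<in> cnj ` I" if "x \<in> cnj ` I" "y \<in> cnj ` I" for x y
        using that ID(3) by (metis (no_types, lifting) complex_cnj_add image_iff)
      show "a * x \<in> cnj ` I" if ax: "a \<in> \<O>" "x \<in> cnj ` I" for a x
      proof -
        obtain y where "y \<in> I" "x = cnj y" using ax by blast
        then have "a * x = cnj (cnj a * y)" "cnj a * y \<in> I"
          using ID(5)[OF integers_cnj[OF ax(1)]] by simp_all
        then show ?thesis by blast
      qed
      show "cnj c * x \<in> \<O>" if "x \<in> cnj ` I" for x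
        using that c(3) integers_cnj by (metis (no_types, lifting) complex_cnj_mult image_iff)
    qed (use u c integers_cnj in simp_all)
  qed
  then have P: "P \<in> \<F>"
    unfolding P_def using I by (rule prod_fractional)
  note PD = fractional_idealD[OF P]
  obtain c where c: "c \<in> \<O>" "c \<noteq> 0" "\<And>x. x \<in> P \<Longrightarrow> c * x \<in> \<O>" using PD(7) by blast
  obtain M where M: "c * cnj c = of_int M"
    using c(1) by (auto simp: integers_iff elim: Ints_cases)
  have "M \<noteq> 0" using M c(2) by auto
  have M_int: "\<exists>k. of_int M * x = of_int k" if "x \<in> P" "x \<in> \<rat>" for x
  proof -
    have "cnj c * (c * x) \<in> \<O>"
      using that c integers_cnj integers_mult by blast
    then have "of_int M * x \<in> \<O>"
      by (simp add: M[symmetric] mult_ac)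
    then have "of_int M * x \<in> \<int>"
      by (rule integers_rat) (use that in auto)
    then show ?thesis by (elim Ints_cases) blast
  qed
  \<comment> \<open>M is a common denominator of the rational elements of P, and S is the group of
    their numerators. Its least positive element d gives the generator g = d / M.\<close>
  define S where "S = {k::int. of_int k / of_int M \<in> P}"
  have S_diff: "k - l * j \<in> S" if "k \<in> S" "j \<in> S" for k l j
  proof -
    have "of_int k / of_int M + of_int (- l) * (of_int j / of_int M) \<in> P"
      using that by (intro PD(3) PD(5) integers_of_int) (auto simp: S_def)
    then show ?thesis by (simp add: S_def diff_divide_distrib)
  qed
  have S_rat: "\<exists>k\<in>S. x = of_int k / of_int M" if x: "x \<in> P" "x \<in> \<rat>" for x
  proof -
    obtain k where "of_int M * x = of_int k" using M_int[OF x] by blast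
    then have "x = of_int k / of_int M"
      using \<open>M \<noteq> 0\<close> by (simp add: field_simps)
    then show ?thesis using x by (auto simp: S_def)
  qed
  have norm_P: "x * cnj x \<in> P" if "x \<in> I" for x
    using prod_memI[of "cnj x" "cnj ` I" x I] that by (simp add: P_def mult.commute)
  obtain u where u: "u \<in> I" "u \<noteq> 0" using ID(6) by blast
  then obtain k where k: "k \<in> S" "u * cnj u = of_int k / of_int M"
    using S_rat[OF norm_P[OF u(1)] norm_rat] ID(1) by blast
  have "k \<noteq> 0" using k(2) u(2) by auto
  have "0 \<in> S" using PD(2) by (simp add: S_def)
  have "nat \<bar>k\<bar> > 0 \<and> int (nat \<bar>k\<bar>) \<in> S"
  proof -
    have "- k \<in> S" using S_diff[OF \<open>0 \<in> S\<close> k(1), of 1] by simp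
    then show ?thesis using k(1) \<open>k \<noteq> 0\<close> by (auto simp: abs_if)
  qed
  then have ex: "\<exists>j. j > 0 \<and> int j \<in> S" by blast
  define d where "d = (LEAST j. j > 0 \<and> int j \<in> S)"
  have d: "d > 0" "int d \<in> S"
    using LeastI_ex[OF ex] by (simp_all add: d_def)
  have d_le: "d \<le> j" if "j > 0" "int j \<in> S" for j
    unfolding d_def by (rule Least_le) (use that in simp)
  have S_dvd: "int d dvd j" if j: "j \<in> S" for j
  proof -
    have "j mod int d \<in> S"
      using S_diff[OF j d(2), of "j div int d"] by (simp add: minus_div_mult_eq_mod)
    moreover have "j mod int d \<ge> 0" "j mod int d < int d"
      using d(1) by auto
    ultimately have "j mod int d = 0"
      using d_le[of "nat (j mod int d)"] by (cases "j mod int d = 0") auto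
    then show ?thesis by auto
  qed
  define g where "g = complex_of_int (int d) / of_int M"
  have "g \<noteq> 0" using d(1) \<open>M \<noteq> 0\<close> by (simp add: g_def)
  have "g \<in> P" using d(2) by (simp add: S_def g_def)
  have "g \<in> \<rat>" by (simp add: g_def)
  then have "g \<in> K" by (rule rat_mem)
  have g_dvd: "x / g \<in> \<int>" if x: "x \<in> P" "x \<in> \<rat>" for x
  proof -
    obtain j where j: "j \<in> S" "x = of_int j / of_int M" using S_rat[OF x] by blast
    obtain i where "j = int d * i" using S_dvd[OF j(1)] by blast
    then have "x / g = of_int i"
      using j(2) d(1) \<open>M \<noteq> 0\<close> by (simp add: g_def)
    then show ?thesis by simp
  qed
  have cnj_g: "cnj g = g" by (simp add: g_def)
  have prod_int: "cnj a * b / g \<in> \<O>" if ab: "a \<in> I" "b \<in> I" for a b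
    unfolding integers_iff
  proof (intro conjI)
    have K: "a \<in> K" "b \<in> K" "cnj a * b \<in> K" using ab ID(1) by (auto intro: mult_mem cnj_mem)
    then show "cnj a * b / g \<in> K" using \<open>g \<in> K\<close> by (intro divide_mem)
    have "cnj a * b + cnj (cnj a * b) \<in> P"
    proof (rule PD(3))
      show "cnj a * b \<in> P" using ab by (auto simp: P_def intro: prod_memI)
      have "cnj b * a \<in> P" using ab by (auto simp: P_def intro: prod_memI)
      then show "cnj (cnj a * b) \<in> P" by (simp add: mult.commute)
    qed
    then have "(cnj a * b + cnj (cnj a * b)) / g \<in> \<int>"
      by (rule g_dvd) (rule trace_rat[OF K(3)])
    then show "cnj a * b / g + cnj (cnj a * b / g) \<in> \<int>"
      by (simp add: cnj_g add_divide_distrib)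
    \<comment> \<open>The norm of cnj a * b / g splits into two factors, each a rational element of
      P divided by g.\<close>
    have "(a * cnj a / g) * (b * cnj b / g) \<in> \<int>"
      using ab K by (intro Ints_mult[OF g_dvd g_dvd] norm_P norm_rat)
    then show "cnj a * b / g * cnj (cnj a * b / g) \<in> \<int>"
      by (simp add: cnj_g mult_ac)
  qed
  have P_eq: "P = principal g"
  proof
    show "P \<subseteq> principal g"
    proof
      fix x assume "x \<in> P"
      then show "x \<in> principal g" unfolding P_def
      proof (induction rule: prod_induct)
        case (mult i j)
        then obtain a where a: "a \<in> I" "i = cnj a" by blast
        have "i * j = g * (i * j / g)" "i * j / g \<in> \<O>"
          using prod_int[OF a(1) mult(2)] \<open>g \<noteq> 0\<close> by (simp_all add: a(2))
        then show ?case by blast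
      qed (rule principal_add)
    qed
    show "principal g \<subseteq> P"
    proof
      fix x assume "x \<in> principal g"
      then obtain u where "u \<in> \<O>" "x = g * u" by blast
      then show "x \<in> P"
        using PD(5)[OF _ \<open>g \<in> P\<close>, of u] by (simp add: mult.commute)
    qed
  qed
  \<comment> \<open>As cnj I times I is generated by g, the inverse of I is the conjugate ideal
    divided by g.\<close>
  have ig: "principal (inverse g) \<in> \<F>"
    using \<open>g \<in> K\<close> \<open>g \<noteq> 0\<close> by (intro principal_fractional inverse_mem) auto
  have "(principal (inverse g) \<diamondop> cnj ` I) \<diamondop> I = principal (inverse g) \<diamondop> principal g"
    unfolding prod_assoc P_def[symmetric] P_eq ..
  also have "\<dots> = \<O>"
    unfolding principal_prod using \<open>g \<noteq> 0\<close> by simp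
  finally show ?thesis
    using prod_fractional[OF ig \<open>cnj ` I \<in> \<F>\<close>] by blast
qed

lemma integers_fractional: "\<O> \<in> \<F>"
  using principal_fractional[OF one_mem] by simp

lemma comm_group_fractional: "comm_group G"
proof (rule comm_groupI)
  show "I \<otimes>\<^bsub>G\<^esub> J = J \<otimes>\<^bsub>G\<^esub> I" for I J
    by (simp add: fractional_ideal_group_def prod_comm)
qed (simp_all add: fractional_ideal_group_def prod_fractional integers_fractional prod_assoc
      integers_prod inverse_fractional)

sublocale FG: comm_group G
  by (rule comm_group_fractional)

lemma subgroup_principal: "subgroup PI G"
proof (rule FG.subgroupI)
  show "PI \<subseteq> carrier G"
    by (auto simp: principal_fractional_ideals_def fractional_ideal_group_def principal_fractional)
  show "PI \<noteq> {}"
    using one_mem by (auto simp: principal_fractional_ideals_def)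
  show "I \<otimes>\<^bsub>G\<^esub> J \<in> PI" if IJ: "I \<in> PI" "J \<in> PI" for I J
  proof -
    obtain a b where "a \<in> K" "a \<noteq> 0" "I = principal a" "b \<in> K" "b \<noteq> 0" "J = principal b"
      using IJ unfolding principal_fractional_ideals_iff by blast
    then have "I \<otimes>\<^bsub>G\<^esub> J = principal (a * b)" "a * b \<in> K" "a * b \<noteq> 0"
      by (simp_all add: fractional_ideal_group_def principal_prod mult_mem)
    then show ?thesis
      unfolding principal_fractional_ideals_iff by blast
  qed
  show "inv\<^bsub>G\<^esub> I \<in> PI" if I: "I \<in> PI" for I
  proof -
    obtain a where a: "a \<in> K" "a \<noteq> 0" "I = principal a"
      using I unfolding principal_fractional_ideals_iff by blast
    have "inv\<^bsub>G\<^esub> I = principal (inverse a)"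
      using a by (intro FG.inv_equality)
        (auto simp: fractional_ideal_group_def principal_prod principal_fractional inverse_mem)
    then show ?thesis
      using inverse_mem[OF a(1)] nonzero_imp_inverse_nonzero[OF a(2)]
      unfolding principal_fractional_ideals_iff by blast
  qed
qed

text \<open>Here n is the order of the class of A. All later arguments about classes go through this
  statement, so cosets do not occur again.\<close>

lemma ideal_class_order:
  assumes "A \<in> \<F>"
  shows "\<exists>n. n dvd class_number K \<and> (\<forall>k. A [^]\<^bsub>G\<^esub> (k::nat) \<in> PI \<longleftrightarrow> n dvd k)"
proof -
  have A: "A \<in> carrier G" using assms by (simp add: fractional_ideal_group_def)
  interpret N: normal PI G
    using FG.normal_iff_subgroup subgroup_principal by blast
  interpret Q: group "ideal_class_group K"
    unfolding ideal_class_group_def by (rule N.factorgroup_is_group)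
  define C where "C = PI #>\<^bsub>G\<^esub> A"
  have C: "C \<in> carrier (ideal_class_group K)"
    using A by (auto simp: C_def ideal_class_group_def carrier_FactGroup)
  have mult: "monoid.mult (ideal_class_group K) = set_mult G"
    by (simp add: ideal_class_group_def FactGroup_def)
  have one: "\<one>\<^bsub>ideal_class_group K\<^esub> = PI"
    by (simp add: ideal_class_group_def)
  have pow: "C [^]\<^bsub>ideal_class_group K\<^esub> (k::nat) = PI #>\<^bsub>G\<^esub> (A [^]\<^bsub>G\<^esub> k)" for k
  proof (induction k)
    case 0
    show ?case
      unfolding nat_pow_0 one by (rule FG.coset_mult_one[OF N.subset, symmetric])
  next
    case (Suc k)
    then show ?case
      unfolding nat_pow_Suc mult C_def by (simp add: N.rcos_sum A)
  qed
  have "A [^]\<^bsub>G\<^esub> (k::nat) \<in> PI \<longleftrightarrow> C [^]\<^bsub>ideal_class_group K\<^esub> k = \<one>\<^bsub>ideal_class_group K\<^esub>" for k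
  proof -
    have "A [^]\<^bsub>G\<^esub> k \<in> carrier G"
      using A by (rule FG.nat_pow_closed)
    then show ?thesis
      unfolding pow one
      using FG.coset_join1[OF _ _ subgroup_principal] FG.coset_join2[OF _ subgroup_principal] by blast
  qed
  then have "A [^]\<^bsub>G\<^esub> (k::nat) \<in> PI \<longleftrightarrow> Q.ord C dvd k" for k
    using Q.pow_eq_id[OF C] by simp
  moreover have "Q.ord C dvd class_number K"
    unfolding class_number_def using Q.ord_dvd_group_order[OF C] .
  ultimately show ?thesis by blast
qed

end

section \<open>The ideal \<open>(m\<^sup>2, \<beta>)\<close>\<close>

lemma generate_field_complex_closed:
  shows "1 \<in> generate_field complex_ring H" "0 \<in> generate_field complex_ring H"
    "x \<in> generate_field complex_ring H \<Longrightarrow> y \<in> generate_field complex_ring H \<Longrightarrow>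
      x + y \<in> generate_field complex_ring H"
    "x \<in> generate_field complex_ring H \<Longrightarrow> y \<in> generate_field complex_ring H \<Longrightarrow>
      x * y \<in> generate_field complex_ring H"
    "x \<in> generate_field complex_ring H \<Longrightarrow> - x \<in> generate_field complex_ring H"
    "x \<in> generate_field complex_ring H \<Longrightarrow> inverse x \<in> generate_field complex_ring H"
proof -
  let ?F = "generate_field complex_ring H"
  show one: "1 \<in> ?F"
    using generate_field.one[of complex_ring H] by (simp add: complex_ring_simps)
  show add: "x + y \<in> ?F" if "x \<in> ?F" "y \<in> ?F" for x y
    using generate_field.eng_add[OF that] by (simp add: complex_ring_simps)
  show "x * y \<in> ?F" if "x \<in> ?F" "y \<in> ?F"
    using generate_field.eng_mult[OF that] by (simp add: complex_ring_simps)
  show minus: "- x \<in> ?F" if "x \<in> ?F" for x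
    using generate_field.a_inv[OF that] by (simp add: complex_ring_a_inv)
  show zero: "0 \<in> ?F"
    using add[OF one minus[OF one]] by simp
  show "inverse x \<in> ?F" if "x \<in> ?F"
    using generate_field.m_inv[OF that] zero
    by (cases "x = 0") (simp_all add: complex_ring_m_inv complex_ring_simps)
qed

lemma rat_sqrt_field_eq: "rat_sqrt_field n = {a + b * csqrt (of_int n) | a b. a \<in> \<rat> \<and> b \<in> \<rat>}"
  (is "_ = ?R")
proof
  define \<theta> where "\<theta> = csqrt (of_int n)"
  let ?F = "generate_field complex_ring {\<theta>}"
  have sq: "\<theta> * \<theta> = of_int n"
    by (simp add: \<theta>_def flip: power2_eq_square)
  have gen: "\<theta> \<in> ?F"
    by (rule generate_field.incl) simp
  note closed = generate_field_complex_closed[where H = "{\<theta>}"]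
  have of_nat: "of_nat k \<in> ?F" for k
    by (induction k) (simp_all add: closed)
  have of_int: "of_int k \<in> ?F" for k
    by (cases k rule: int_cases2) (simp_all add: of_nat closed)
  have rat: "x \<in> ?F" if "x \<in> \<rat>" for x
    using that by (elim Rats_cases') (simp add: divide_inverse closed of_int)
  show "?R \<subseteq> rat_sqrt_field n"
    unfolding rat_sqrt_field_def \<theta>_def[symmetric] using closed rat gen by auto
  have R_I: "a + b * \<theta> \<in> ?R" if "a \<in> \<rat>" "b \<in> \<rat>" for a b
    using that by (auto simp: \<theta>_def)
  have R_E: "\<exists>a\<in>\<rat>. \<exists>b\<in>\<rat>. x = a + b * \<theta>" if "x \<in> ?R" for x
    using that by (auto simp: \<theta>_def)
  show "rat_sqrt_field n \<subseteq> ?R"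
  proof
    fix x assume "x \<in> rat_sqrt_field n"
    then have "x \<in> ?F" by (simp add: rat_sqrt_field_def \<theta>_def)
    then show "x \<in> ?R"
    proof (induction rule: generate_field.induct)
      case one
      show ?case using R_I[of 1 0] by (simp add: complex_ring_simps)
    next
      case (incl h)
      then show ?case using R_I[of 0 1] by simp
    next
      case (a_inv h)
      obtain a b where ab: "a \<in> \<rat>" "b \<in> \<rat>" "h = a + b * \<theta>" using R_E[OF a_inv(2)] by blast
      show ?case using R_I[of "- a" "- b"] ab by (simp add: complex_ring_a_inv)
    next
      case (m_inv h)
      obtain a b where ab: "a \<in> \<rat>" "b \<in> \<rat>" "h = a + b * \<theta>" using R_E[OF m_inv(3)] by blast
      have "h \<noteq> 0" using m_inv by (simp add: complex_ring_simps)
      have "inverse h \<in> ?R"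
      proof (cases "a - b * \<theta> = 0")
        \<comment> \<open>When n is a square, the algebraic conjugate of a nonzero h may vanish; h
          is then rational.\<close>
        case True
        then have "h = 2 * a" using ab(3) by simp
        then show ?thesis using R_I[of "inverse h" 0] ab(1) by simp
      next
        case False
        have N: "h * (a - b * \<theta>) = a * a - b * b * of_int n"
          unfolding ab(3) sq[symmetric] by (simp add: algebra_simps)
        define N where "N = a * a - b * b * of_int n"
        have "N \<in> \<rat>" unfolding N_def using ab by simp
        have "N \<noteq> 0" using False \<open>h \<noteq> 0\<close> N by (metis N_def mult_eq_0_iff)
        have "inverse h = a * inverse N + (- b * inverse N) * \<theta>"
          using N[folded N_def] \<open>h \<noteq> 0\<close> \<open>N \<noteq> 0\<close> by (simp add: field_simps)
        then show ?thesis
          using R_I[of "a * inverse N" "- b * inverse N"] \<open>N \<in> \<rat>\<close> ab by simp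
      qed
      then show ?case using \<open>h \<noteq> 0\<close> by (simp add: complex_ring_m_inv)
    next
      case (eng_add h h')
      obtain a b where ab: "a \<in> \<rat>" "b \<in> \<rat>" "h = a + b * \<theta>" using R_E[OF eng_add(3)] by blast
      obtain a' b' where ab': "a' \<in> \<rat>" "b' \<in> \<rat>" "h' = a' + b' * \<theta>" using R_E[OF eng_add(4)] by blast
      show ?case using R_I[of "a + a'" "b + b'"] ab ab' by (simp add: complex_ring_simps algebra_simps)
    next
      case (eng_mult h h')
      obtain a b where ab: "a \<in> \<rat>" "b \<in> \<rat>" "h = a + b * \<theta>" using R_E[OF eng_mult(3)] by blast
      obtain a' b' where ab': "a' \<in> \<rat>" "b' \<in> \<rat>" "h' = a' + b' * \<theta>" using R_E[OF eng_mult(4)] by blast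
      have "h * h' = (a * a' + b * b' * of_int n) + (a * b' + a' * b) * \<theta>"
        unfolding ab ab' sq[symmetric] by (simp add: algebra_simps)
      then show ?case
        using R_I[of "a * a' + b * b' * of_int n" "a * b' + a' * b"] ab ab'
        by (simp add: complex_ring_simps)
    qed
  qed
qed

lemma cnj_csqrt_neg:
  assumes "n < 0"
  shows "cnj (csqrt (of_int n)) = - csqrt (of_int n)"
  using assms by simp

text \<open>For negative n complex conjugation negates the square root, so a + b \<theta> has trace
  2 a and norm a^2 - b^2 n.\<close>

lemma quadratic_subfield_rat_sqrt_field:
  assumes "n < 0"
  shows "quadratic_subfield (rat_sqrt_field n)"
proof -
  define \<theta> where "\<theta> = csqrt (of_int n)"
  have sq: "\<theta> * \<theta> = of_int n"
    by (simp add: \<theta>_def flip: power2_eq_square)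
  have cnj: "cnj \<theta> = - \<theta>"
    unfolding \<theta>_def by (rule cnj_csqrt_neg[OF assms])
  let ?F = "generate_field complex_ring {\<theta>}"
  have F: "rat_sqrt_field n = ?F"
    by (simp add: rat_sqrt_field_def \<theta>_def)
  note closed = generate_field_complex_closed[where H = "{\<theta>}"]
  have ex: "\<exists>a\<in>\<rat>. \<exists>b\<in>\<rat>. x = a + b * \<theta> \<and> cnj x = a + (- b) * \<theta>" if "x \<in> rat_sqrt_field n" for x
  proof -
    have real: "cnj a = a" if "a \<in> \<rat>" for a
      using that by (elim Rats_cases') simp
    obtain a b where "a \<in> \<rat>" "b \<in> \<rat>" "x = a + b * \<theta>"
      using \<open>x \<in> rat_sqrt_field n\<close> unfolding rat_sqrt_field_eq \<theta>_def by blast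
    then show ?thesis using real cnj by (intro bexI[of _ a] bexI[of _ b]) simp_all
  qed
  show ?thesis
  proof
    fix x assume x: "x \<in> rat_sqrt_field n"
    obtain a b where ab: "a \<in> \<rat>" "b \<in> \<rat>" "x = a + b * \<theta>" "cnj x = a + (- b) * \<theta>"
      using ex[OF x] by blast
    show "cnj x \<in> rat_sqrt_field n"
      unfolding rat_sqrt_field_eq \<theta>_def[symmetric] ab(4)
      using ab(1,2) by (intro CollectI exI[of _ a] exI[of _ "- b"]) simp
    have "x + cnj x = a + b * \<theta> + (a + (- b) * \<theta>)"
      unfolding ab(4) by (simp only: ab(3))
    then show "x + cnj x \<in> \<rat>"
      using ab(1) by simp
    have "x * cnj x = (a + b * \<theta>) * (a + (- b) * \<theta>)"
      unfolding ab(4) by (simp only: ab(3))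
    also have "\<dots> = a * a - b * b * of_int n"
      unfolding sq[symmetric] by (simp add: algebra_simps)
    finally have "x * cnj x = a * a - b * b * of_int n" .
    then show "x * cnj x \<in> \<rat>"
      using ab(1,2) by simp
  qed (simp_all only: F closed)
qed

lemma csqrt_mem_rat_sqrt_field: "csqrt (of_int n) \<in> rat_sqrt_field n"
  unfolding rat_sqrt_field_def by (rule generate_field.incl) simp

section \<open>Power sums and elementary arithmetic\<close>

lemma half_trace_power_sum:
  fixes x y :: complex
  assumes "x + y = 2" "x * y = of_int (2 * (1 + 2 * s))"
  shows "x ^ (2 * k + 1) + y ^ (2 * k + 1) = of_int (2 ^ (k + 1) * half_trace s k)"
proof (induction k rule: induct_nat_012)
  case 0
  show ?case using assms(1) by simp
next
  case 1
  have "x ^ 3 + y ^ 3 = (x + y) ^ 3 - 3 * (x * y) * (x + y)"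
    by (simp add: power3_eq_cube algebra_simps)
  also have "\<dots> = of_int (4 * (- 1 - 6 * s))"
    unfolding assms by simp
  finally show ?case by (simp add: numeral_3_eq_3)
next
  case (ge2 k)
  let ?S = "\<lambda>k. x ^ (2 * k + 1) + y ^ (2 * k + 1)"
  have "x ^ 2 + y ^ 2 = (x + y) ^ 2 - 2 * (x * y)"
    by (simp add: power2_eq_square algebra_simps)
  also have "\<dots> = of_int (- 8 * s)"
    unfolding assms by simp
  finally have sq: "x ^ 2 + y ^ 2 = of_int (- 8 * s)" .
  have "?S (Suc (Suc k)) = (x ^ 2 + y ^ 2) * ?S (Suc k) - (x * y) ^ 2 * ?S k"
    by (simp add: power_add power2_eq_square algebra_simps)
  also have "\<dots> = of_int (- 8 * s * (2 ^ (k + 2) * half_trace s (Suc k))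
      - (2 * (1 + 2 * s)) ^ 2 * (2 ^ (k + 1) * half_trace s k))"
    unfolding sq assms(2) using ge2 by simp
  also have "\<dots> = of_int (2 ^ (Suc (Suc k) + 1) * half_trace s (Suc (Suc k)))"
    by (simp add: power2_eq_square algebra_simps)
  finally show ?case .
qed


text \<open>The cofactor of x + y in an odd power sum is a symmetric integer polynomial in x and y.
  Later this shows that the trace of \<gamma> divides a power of 2.\<close>

lemma trace_dvd_odd_power_sum:
  fixes x y :: complex and T n :: int
  assumes "x + y = of_int T" "x * y = of_int n"
  shows "\<exists>z::int. x ^ (2 * k + 1) + y ^ (2 * k + 1) = of_int (T * z)"
proof (induction k rule: induct_nat_012)
  case 0
  show ?case using assms(1) by (intro exI[of _ 1]) simp
next
  case 1
  have "x ^ 3 + y ^ 3 = (x + y) * ((x + y) ^ 2 - 3 * (x * y))"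
    by (simp add: power2_eq_square power3_eq_cube algebra_simps)
  also have "\<dots> = of_int (T * (T ^ 2 - 3 * n))"
    unfolding assms by simp
  finally show ?case by (intro exI[of _ "T ^ 2 - 3 * n"]) (simp add: numeral_3_eq_3)
next
  case (ge2 k)
  let ?S = "\<lambda>k. x ^ (2 * k + 1) + y ^ (2 * k + 1)"
  obtain z z' where z: "?S k = of_int (T * z)" "?S (Suc k) = of_int (T * z')"
    using ge2 by (auto simp only: Suc_eq_plus1)
  have "x ^ 2 + y ^ 2 = (x + y) ^ 2 - 2 * (x * y)"
    by (simp add: power2_eq_square algebra_simps)
  also have "\<dots> = of_int (T ^ 2 - 2 * n)"
    unfolding assms by simp
  finally have sq: "x ^ 2 + y ^ 2 = of_int (T ^ 2 - 2 * n)" .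
  have "?S (Suc (Suc k)) = (x ^ 2 + y ^ 2) * ?S (Suc k) - (x * y) ^ 2 * ?S k"
    by (simp add: power_add power2_eq_square algebra_simps)
  also have "\<dots> = of_int (T * ((T ^ 2 - 2 * n) * z' - n ^ 2 * z))"
    unfolding sq assms(2) z by (simp add: algebra_simps)
  finally show ?case by blast
qed

text \<open>For nonzero c the exponent of 2 is even on the left and odd on the right. This excludes
  a square root of twice an odd number from a quadratic field generated by the root of an odd
  one.\<close>

lemma odd_times_square_neq:
  fixes a b c d :: int
  assumes "odd a" "odd b" "d \<noteq> 0"
  shows "a * c ^ 2 \<noteq> 2 * b * d ^ 2"
proof
  assume eq: "a * c ^ 2 = 2 * b * d ^ 2"
  define g where "g = gcd c d"
  have "g \<noteq> 0" using assms(3) by (simp add: g_def)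
  obtain u v where uv: "c = u * g" "d = v * g" "Rings.coprime u v"
    using gcd_coprime_exists[of c d] \<open>g \<noteq> 0\<close> unfolding g_def by blast
  have "(a * u ^ 2) * g ^ 2 = (2 * b * v ^ 2) * g ^ 2"
    using eq unfolding uv by (simp add: power_mult_distrib mult_ac)
  then have eq': "a * u ^ 2 = 2 * b * v ^ 2"
    using \<open>g \<noteq> 0\<close> by simp
  have "even (a * u ^ 2)" unfolding eq' by simp
  then have "even u" using assms(1) by simp
  then obtain w where w: "u = 2 * w" by (elim evenE)
  have "2 * (b * v ^ 2) = 2 * (2 * a * w ^ 2)"
    using eq' unfolding w by (simp add: power2_eq_square mult_ac)
  then have "b * v ^ 2 = 2 * a * w ^ 2" by linarith
  then have "even (b * v ^ 2)" by simp
  then have "even v" using assms(2) by simp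
  with \<open>even u\<close> uv(3) show False
    using coprime_common_divisor[of u v 2] by simp
qed

text \<open>Residues prime to 12 square to 1. As the units of norm 1 have order dividing 12, raising
  them to the power p is an involution, so each of them is a p-th power.\<close>

lemma prime_square_mod_12:
  fixes p :: nat
  assumes "Factorial_Ring.prime p" "p > 3"
  shows "p\<^sup>2 mod 12 = 1"
proof -
  have "\<not> 2 dvd p" "\<not> 3 dvd p"
    using assms unfolding prime_nat_iff by fastforce+
  then have "p mod 12 \<in> {1, 5, 7, 11}"
    by (simp, presburger)
  moreover have "p\<^sup>2 mod 12 = (p mod 12)\<^sup>2 mod 12"
    by (simp add: power_mod)
  ultimately show ?thesis by auto
qed

section \<open>Powers of ideals with two generators\<close>

context quadratic_subfield
begin

definition two_generated :: "int \<Rightarrow> complex \<Rightarrow> complex set" where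
  "two_generated M \<beta> = {of_int M * u + \<beta> * v | u v. u \<in> \<O> \<and> v \<in> \<O>}"

lemma two_generated_I: "u \<in> \<O> \<Longrightarrow> v \<in> \<O> \<Longrightarrow> of_int M * u + \<beta> * v \<in> two_generated M \<beta>"
  by (auto simp: two_generated_def)

lemma two_generated_E:
  assumes "x \<in> two_generated M \<beta>"
  obtains u v where "u \<in> \<O>" "v \<in> \<O>" "x = of_int M * u + \<beta> * v"
  using assms by (auto simp: two_generated_def)

text \<open>This is how the ideals belonging to two different primes are identified when they live
  in the same field.\<close>

lemma two_generated_cong:
  assumes "w \<in> \<O>" "\<beta> = \<beta>' + of_int M * w"
  shows "two_generated M \<beta> = two_generated M \<beta>'"
proof -
  have sub: "two_generated M \<beta> \<subseteq> two_generated M \<beta>'"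
    if w: "w \<in> \<O>" and \<beta>: "\<beta> = \<beta>' + of_int M * w" for w \<beta> \<beta>'
  proof
    fix x assume "x \<in> two_generated M \<beta>"
    then obtain u v where uv: "u \<in> \<O>" "v \<in> \<O>" "x = of_int M * u + \<beta> * v"
      by (rule two_generated_E)
    have "x = of_int M * (u + w * v) + \<beta>' * v"
      unfolding uv \<beta> by (simp add: algebra_simps)
    then show "x \<in> two_generated M \<beta>'"
      using two_generated_I[OF integers_add[OF uv(1) integers_mult[OF w uv(2)]] uv(2)] by simp
  qed
  show ?thesis
    using sub[OF assms] sub[of "- w" \<beta>' \<beta>] integers_uminus[OF assms(1)] assms(2) by auto
qed

lemma two_generated_fractional:
  assumes "\<beta> \<in> \<O>" "M \<noteq> 0"
  shows "two_generated M \<beta> \<in> \<F>"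
proof (rule fractional_idealI[where u = "of_int M" and c = 1])
  have sub: "two_generated M \<beta> \<subseteq> \<O>"
    using assms by (auto elim!: two_generated_E intro!: integers_add integers_mult integers_of_int)
  then show "two_generated M \<beta> \<subseteq> K" using integers_mem by blast
  show "of_int M \<in> two_generated M \<beta>"
    using two_generated_I[OF integers_of_int[of 1] integers_of_int[of 0], of M \<beta>] by simp
  show "1 * x \<in> \<O>" if "x \<in> two_generated M \<beta>" for x using that sub by auto
  show "x + y \<in> two_generated M \<beta>" if x: "x \<in> two_generated M \<beta>" and y: "y \<in> two_generated M \<beta>" for x y
  proof -
    obtain u v where uv: "u \<in> \<O>" "v \<in> \<O>" "x = of_int M * u + \<beta> * v"
      using x by (rule two_generated_E)
    obtain u' v' where uv': "u' \<in> \<O>" "v' \<in> \<O>" "y = of_int M * u' + \<beta> * v'"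
      using y by (rule two_generated_E)
    have "x + y = of_int M * (u + u') + \<beta> * (v + v')"
      unfolding uv uv' by (simp add: algebra_simps)
    then show ?thesis
      using two_generated_I[OF integers_add[OF uv(1) uv'(1)] integers_add[OF uv(2) uv'(2)]] by simp
  qed
  show "a * x \<in> two_generated M \<beta>" if a: "a \<in> \<O>" and x: "x \<in> two_generated M \<beta>" for a x
  proof -
    obtain u v where uv: "u \<in> \<O>" "v \<in> \<O>" "x = of_int M * u + \<beta> * v"
      using x by (rule two_generated_E)
    have "a * x = of_int M * (a * u) + \<beta> * (a * v)"
      unfolding uv by (simp add: algebra_simps)
    then show ?thesis
      using two_generated_I[OF integers_mult[OF a uv(1)] integers_mult[OF a uv(2)]] by simp
  qed
qed (use assms integers_of_int[of 1] in simp_all)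

lemma pow_fractional: "A \<in> \<F> \<Longrightarrow> A [^]\<^bsub>G\<^esub> (k::nat) \<in> \<F>"
  using FG.nat_pow_closed[of A k] by (simp add: fractional_ideal_group_def)

lemma pow_Suc_fractional: "A [^]\<^bsub>G\<^esub> Suc k = A [^]\<^bsub>G\<^esub> k \<diamondop> A"
  by (simp add: fractional_ideal_group_def)

lemma pow_0_fractional: "A [^]\<^bsub>G\<^esub> (0::nat) = \<O>"
  unfolding FG.nat_pow_0 unfolding fractional_ideal_group_def by simp

lemma power_mem_pow: "x \<in> A \<Longrightarrow> x ^ k \<in> A [^]\<^bsub>G\<^esub> k"
proof (induction k)
  case 0
  show ?case using integers_of_int[of 1] unfolding pow_0_fractional by simp
next
  case (Suc k)
  then have "x ^ k * x \<in> A [^]\<^bsub>G\<^esub> Suc k"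
    unfolding pow_Suc_fractional by (intro prod_memI)
  then show ?case by (simp add: mult.commute)
qed

lemma principal_pow: "principal a [^]\<^bsub>G\<^esub> k = principal (a ^ k)"
proof (induction k)
  case 0
  show ?case unfolding pow_0_fractional by simp
next
  case (Suc k)
  show ?case unfolding pow_Suc_fractional Suc principal_prod power_Suc2 ..
qed

text \<open>In a product of elements of (M^k, \<beta>) and (M, \<beta>) every term except the one
  with M^(k+1) contains \<beta>.\<close>

lemma two_generated_pow_subset:
  assumes "\<beta> \<in> \<O>"
  shows "two_generated M \<beta> [^]\<^bsub>G\<^esub> k \<subseteq> two_generated (M ^ k) \<beta>"
proof (induction k)
  case 0
  show ?case
  proof
    fix x assume "x \<in> two_generated M \<beta> [^]\<^bsub>G\<^esub> (0::nat)"
    then show "x \<in> two_generated (M ^ 0) \<beta>"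
      using two_generated_I[OF _ integers_of_int[of 0], of x 1 \<beta>] unfolding pow_0_fractional by simp
  qed
next
  case (Suc k)
  show ?case
  proof
    fix x assume "x \<in> two_generated M \<beta> [^]\<^bsub>G\<^esub> Suc k"
    then have "x \<in> two_generated M \<beta> [^]\<^bsub>G\<^esub> k \<diamondop> two_generated M \<beta>"
      unfolding pow_Suc_fractional .
    then show "x \<in> two_generated (M ^ Suc k) \<beta>"
    proof (induction rule: prod_induct)
      case (mult i j)
      obtain u v where uv: "u \<in> \<O>" "v \<in> \<O>" "i = of_int (M ^ k) * u + \<beta> * v"
        using mult(1) Suc.IH by (meson subsetD two_generated_E)
      obtain u' v' where uv': "u' \<in> \<O>" "v' \<in> \<O>" "j = of_int M * u' + \<beta> * v'"
        using mult(2) by (rule two_generated_E)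
      have "i * j = of_int (M ^ Suc k) * (u * u')
          + \<beta> * (of_int (M ^ k) * (u * v') + v * (of_int M * u') + \<beta> * (v * v'))"
        unfolding uv uv' by (simp add: algebra_simps)
      moreover have "u * u' \<in> \<O>"
        "of_int (M ^ k) * (u * v') + v * (of_int M * u') + \<beta> * (v * v') \<in> \<O>"
        by (intro integers_add integers_mult integers_of_int uv uv' assms)+
      ultimately show ?case by (simp only: two_generated_I)
    next
      case (add a b)
      obtain u v where uv: "u \<in> \<O>" "v \<in> \<O>" "a = of_int (M ^ Suc k) * u + \<beta> * v"
        using add(1) by (rule two_generated_E)
      obtain u' v' where uv': "u' \<in> \<O>" "v' \<in> \<O>" "b = of_int (M ^ Suc k) * u' + \<beta> * v'"
        using add(2) by (rule two_generated_E)
      have "a + b = of_int (M ^ Suc k) * (u + u') + \<beta> * (v + v')"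
        unfolding uv uv' by (simp add: algebra_simps)
      then show ?case
        using two_generated_I[OF integers_add[OF uv(1) uv'(1)] integers_add[OF uv(2) uv'(2)]] by (simp only:)
    qed
  qed
qed

text \<open>Trace and norm both lie in the ideal (\<beta>, cnj \<beta>), so a Bezout relation
  between them gives the case k = 1. Multiplying by that relation raises the exponent.\<close>

lemma coprime_conjugate_power:
  assumes \<beta>: "\<beta> \<in> \<O>" and t: "\<beta> + cnj \<beta> = of_int t" and n: "\<beta> * cnj \<beta> = of_int n"
    and "Rings.coprime t n"
  shows "\<exists>x\<in>\<O>. \<exists>y\<in>\<O>. x * \<beta> ^ k + y * cnj \<beta> = 1"
proof -
  note O = integers_mult integers_add integers_of_int integers_cnj \<beta>
  obtain r s where "r * t + s * n = 1"
    using assms(4) by (metis bezout_int coprime_imp_gcd_eq_1)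
  then have rs: "of_int r * of_int t + of_int s * of_int n = (1::complex)"
    by (metis of_int_1 of_int_add of_int_mult)
  define b where "b = of_int r + of_int s * \<beta>"
  have "b \<in> \<O>" unfolding b_def by (intro O)
  have ab: "of_int r * \<beta> + b * cnj \<beta> = 1"
    unfolding rs[symmetric] t[symmetric] n[symmetric] b_def by (simp add: algebra_simps)
  show ?thesis
  proof (induction k)
    case 0
    show ?case
      using integers_of_int[of 1] integers_of_int[of 0] by (intro bexI[of _ 1] bexI[of _ 0]) simp_all
  next
    case (Suc k)
    then obtain x y where xy: "x \<in> \<O>" "y \<in> \<O>" "x * \<beta> ^ k + y * cnj \<beta> = 1" by blast
    have "(x * of_int r) * \<beta> ^ Suc k + (x * \<beta> ^ k * b + y) * cnj \<beta>
        = x * \<beta> ^ k * (of_int r * \<beta> + b * cnj \<beta>) + y * cnj \<beta>"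
      by (simp add: algebra_simps)
    also have "\<dots> = 1" unfolding ab using xy(3) by simp
    finally have "(x * of_int r) * \<beta> ^ Suc k + (x * \<beta> ^ k * b + y) * cnj \<beta> = 1" .
    moreover have "x * of_int r \<in> \<O>" "x * \<beta> ^ k * b + y \<in> \<O>"
      by (intro O xy \<open>b \<in> \<O>\<close> integers_power)+
    ultimately show ?case by blast
  qed
qed

text \<open>Since M^p = \<beta> * cnj \<beta>, the ideal (M^p, \<beta>) is just (\<beta>), and it
  contains the p-th power. Conversely the p-th power contains \<beta> * \<beta>^(p-1) and \<beta> *
  cnj \<beta>, whose cofactors are coprime.\<close>

lemma two_generated_pow:
  assumes \<beta>: "\<beta> \<in> \<O>" and t: "\<beta> + cnj \<beta> = of_int t" and n: "\<beta> * cnj \<beta> = of_int (M ^ p)"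
    and cop: "Rings.coprime t (M ^ p)" and "M \<noteq> 0" "p \<noteq> 0"
  shows "two_generated M \<beta> [^]\<^bsub>G\<^esub> p = principal \<beta>"
proof
  let ?A = "two_generated M \<beta>"
  show "?A [^]\<^bsub>G\<^esub> p \<subseteq> principal \<beta>"
  proof
    fix x assume "x \<in> ?A [^]\<^bsub>G\<^esub> p"
    then have "x \<in> two_generated (M ^ p) \<beta>"
      using two_generated_pow_subset[OF \<beta>] by blast
    then obtain u v where uv: "u \<in> \<O>" "v \<in> \<O>" "x = of_int (M ^ p) * u + \<beta> * v"
      by (rule two_generated_E)
    have "x = \<beta> * (cnj \<beta> * u + v)"
      unfolding uv n[symmetric] by (simp add: algebra_simps)
    moreover have "cnj \<beta> * u + v \<in> \<O>"
      by (intro integers_add integers_mult integers_cnj \<beta> uv)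
    ultimately show "x \<in> principal \<beta>" by blast
  qed
  show "principal \<beta> \<subseteq> ?A [^]\<^bsub>G\<^esub> p"
  proof
    fix z assume "z \<in> principal \<beta>"
    then obtain w where w: "w \<in> \<O>" "z = \<beta> * w" by blast
    obtain x y where xy: "x \<in> \<O>" "y \<in> \<O>" "x * \<beta> ^ (p - 1) + y * cnj \<beta> = 1"
      using coprime_conjugate_power[OF \<beta> t n cop] by blast
    have F: "?A [^]\<^bsub>G\<^esub> p \<in> \<F>"
      using pow_fractional two_generated_fractional[OF \<beta> \<open>M \<noteq> 0\<close>] by blast
    have "\<beta> \<in> ?A"
      using two_generated_I[OF integers_of_int[of 0] integers_of_int[of 1], of M \<beta>] by simp
    then have 1: "\<beta> ^ p \<in> ?A [^]\<^bsub>G\<^esub> p" by (rule power_mem_pow)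
    have "of_int M \<in> ?A"
      using two_generated_I[OF integers_of_int[of 1] integers_of_int[of 0], of M \<beta>] by simp
    then have 2: "of_int M ^ p \<in> ?A [^]\<^bsub>G\<^esub> p" by (rule power_mem_pow)
    have "z = \<beta> * w * (x * \<beta> ^ (p - 1) + y * cnj \<beta>)"
      using xy(3) w(2) by simp
    also have "\<dots> = (x * w) * (\<beta> * \<beta> ^ (p - 1)) + (y * w) * (\<beta> * cnj \<beta>)"
      by (simp add: algebra_simps)
    also have "\<dots> = (x * w) * \<beta> ^ p + (y * w) * of_int M ^ p"
      using \<open>p \<noteq> 0\<close> unfolding n by (simp flip: power_Suc)
    finally show "z \<in> ?A [^]\<^bsub>G\<^esub> p"
      using fractional_idealD(3)[OF F fractional_idealD(5)[OF F integers_mult[OF xy(1) w(1)] 1]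
          fractional_idealD(5)[OF F integers_mult[OF xy(2) w(1)] 2]] by simp
  qed
qed

end

section \<open>The principal case\<close>

context quadratic_subfield
begin

lemma norm_eq_of_real: "x * cnj x = of_real ((cmod x)\<^sup>2)"
  by (simp only: complex_norm_square)

text \<open>Norm 1 means absolute value 1, so the integral trace T is at most 2 in absolute value
  and \<epsilon> is a root of one of five polynomials X^2 - T X + 1. The possible orders are 1, 2,
  3, 4 and 6, with least common multiple 12.\<close>

lemma unit_power_12:
  assumes "\<epsilon> \<in> \<O>" "\<epsilon> * cnj \<epsilon> = 1"
  shows "\<epsilon> ^ 12 = 1"
proof -
  obtain T where T: "\<epsilon> + cnj \<epsilon> = of_int T"
    using assms(1) by (auto simp: integers_iff elim: Ints_cases)
  have "cmod \<epsilon> ^ 2 = 1"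
    using assms(2) unfolding norm_eq_of_real using of_real_eq_1_iff by blast
  then have "cmod \<epsilon> = 1"
    using norm_ge_zero[of \<epsilon>] unfolding power2_eq_1_iff by linarith
  have "real_of_int T = 2 * Re \<epsilon>"
    using arg_cong[OF T, of Re] by simp
  then have "\<bar>real_of_int T\<bar> \<le> 2"
    using abs_Re_le_cmod[of \<epsilon>] \<open>cmod \<epsilon> = 1\<close> by linarith
  then have "T \<in> {-2, -1, 0, 1, 2}"
    by auto
  have sq: "\<epsilon> * \<epsilon> = of_int T * \<epsilon> - 1"
    unfolding T[symmetric] assms(2)[symmetric] by (simp add: algebra_simps)
  have "\<epsilon> * \<epsilon> * \<epsilon> = (of_int T * \<epsilon> - 1) * \<epsilon>"
    by (simp only: sq)
  also have "\<dots> = of_int T * (\<epsilon> * \<epsilon>) - \<epsilon>"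
    by (simp add: algebra_simps)
  also have "\<dots> = of_int T * (of_int T * \<epsilon> - 1) - \<epsilon>"
    by (simp only: sq)
  also have "\<dots> = of_int (T * T - 1) * \<epsilon> - of_int T"
    by (simp add: algebra_simps)
  finally have cube: "\<epsilon> * \<epsilon> * \<epsilon> = of_int (T * T - 1) * \<epsilon> - of_int T" .
  have e12: "\<epsilon> ^ 12 = ((\<epsilon> * \<epsilon>) * \<epsilon>) ^ 4"
    by (simp add: power_mult_distrib flip: power_add power_Suc power_mult power2_eq_square)
  consider "T = 2" | "T = - 2" | "T = 1" | "T = - 1" | "T = 0"
    using \<open>T \<in> _\<close> by blast
  then show ?thesis
  proof cases
    case 1
    have "(\<epsilon> - 1) * (\<epsilon> - 1) = \<epsilon> * \<epsilon> - 2 * \<epsilon> + 1" by (simp add: algebra_simps)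
    also have "\<dots> = 0" unfolding sq 1 by simp
    finally have "(\<epsilon> - 1) * (\<epsilon> - 1) = 0" .
    then show ?thesis by simp
  next
    case 2
    have "(\<epsilon> + 1) * (\<epsilon> + 1) = \<epsilon> * \<epsilon> + 2 * \<epsilon> + 1" by (simp add: algebra_simps)
    also have "\<dots> = 0" unfolding sq 2 by simp
    finally have "(\<epsilon> + 1) * (\<epsilon> + 1) = 0" .
    then have "\<epsilon> = - 1" by (simp add: eq_neg_iff_add_eq_0)
    then show ?thesis by simp
  next
    case 3
    have "\<epsilon> * \<epsilon> * \<epsilon> = - 1" unfolding cube 3 by simp
    then show ?thesis unfolding e12 by simp
  next
    case 4
    have "\<epsilon> * \<epsilon> * \<epsilon> = 1" unfolding cube 4 by simp
    then show ?thesis unfolding e12 by simp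
  next
    case 5
    have "\<epsilon> ^ 12 = (\<epsilon> * \<epsilon>) ^ 6"
      by (simp flip: power_mult power2_eq_square)
    then show ?thesis unfolding sq 5 by simp
  qed
qed

text \<open>The generators differ by a unit. Its norm is an integer dividing 1 and, being a squared
  absolute value, it is not -1.\<close>

lemma principal_eqD:
  assumes "principal a = principal b" "a \<noteq> 0" "b \<noteq> 0"
  obtains \<epsilon> where "\<epsilon> \<in> \<O>" "\<epsilon> * cnj \<epsilon> = 1" "b = a * \<epsilon>"
proof -
  have gen: "x \<in> principal x" for x
    using imageI[OF integers_of_int[of 1], of "\<lambda>y. x * y"] by simp
  have "b \<in> principal a" "a \<in> principal b"
    using gen[of a] gen[of b] assms(1) by simp_all
  then obtain e e' where e: "e \<in> \<O>" "b = a * e" "e' \<in> \<O>" "a = b * e'" by blast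
  have "a * (e * e') = a * 1"
    using e(2,4) by (metis mult.assoc mult.right_neutral)
  then have ee: "e * e' = 1"
    using assms(2) by simp
  obtain N where N: "e * cnj e = of_int N"
    using e(1) by (auto simp: integers_iff elim: Ints_cases)
  obtain N' where N': "e' * cnj e' = of_int N'"
    using e(3) by (auto simp: integers_iff elim: Ints_cases)
  have "of_int (N * N') = (e * e') * cnj (e * e')"
    by (simp add: N[symmetric] N'[symmetric] mult_ac)
  then have "of_int (N * N') = (1::complex)"
    unfolding ee by simp
  then have "N * N' = 1"
    by (metis of_int_1 of_int_eq_iff)
  moreover have "real_of_int N = (cmod e)\<^sup>2"
    using N unfolding norm_eq_of_real by (metis of_real_eq_iff of_real_of_int_eq)
  then have "N \<ge> 0"
    by (metis of_int_0_le_iff zero_le_power2)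
  ultimately have "N = 1"
    by (simp add: zmult_eq_1_iff)
  then show ?thesis using that[OF e(1) _ e(2)] N by simp
qed

text \<open>
  Here \<open>\<alpha> = 1 + \<theta>\<close> and \<open>\<alpha>\<^sup>2 = 2 \<beta>\<close>. Correcting \<open>\<kappa>\<close> by a unit gives \<open>\<nu> ^ p = \<beta>\<close>, which works because
  \<open>p\<^sup>2\<close> is 1 mod 12 and the order of every unit divides 12. Then \<open>\<gamma> = \<alpha> / \<nu> ^ ((p - 1) / 2)\<close> satisfies
  \<open>\<gamma>\<^sup>2 = 2 \<nu>\<close>. Its trace is even and divides a power of 2; it is not divisible by 4, since otherwise
  \<open>K\<close> would contain a square root of twice an odd number.
\<close>

lemma principal_root_trace:
  fixes s :: int and p :: nat
  defines "m \<equiv> 1 + 2 * s"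
  assumes \<theta>: "\<theta> \<in> K" "\<theta> * \<theta> = of_int (1 - 2 * m ^ p)" "cnj \<theta> = - \<theta>"
    and s: "s \<ge> 1" and p: "Factorial_Ring.prime p" "p > 3"
    and \<kappa>: "\<kappa> \<in> \<O>" and pow: "principal \<kappa> [^]\<^bsub>G\<^esub> p = principal (of_int (1 - m ^ p) + \<theta>)"
  shows "\<bar>half_trace s ((p - 1) div 2)\<bar> = 1"
proof -
  define \<beta> where "\<beta> = of_int (1 - m ^ p) + \<theta>"
  define \<alpha> where "\<alpha> = 1 + \<theta>"
  define q where "q = (p - 1) div 2"
  have "odd p" using p prime_odd_nat[of p] by simp
  then have pq: "p = 2 * q + 1" by (simp add: q_def)
  have "m \<ge> 3" using s by (simp add: m_def)
  have "odd m" by (simp add: m_def)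
  have mp: "m ^ p \<ge> 1" using \<open>m \<ge> 3\<close> by simp
  have \<alpha>\<beta>: "\<alpha> ^ 2 = 2 * \<beta>"
    using \<theta>(2) by (simp add: \<alpha>_def \<beta>_def power2_eq_square algebra_simps)
  have \<alpha>N: "\<alpha> * cnj \<alpha> = of_int (2 * m ^ p)"
    using \<theta>(2) by (simp add: \<alpha>_def \<theta>(3) algebra_simps)
  have "\<alpha> \<noteq> 0"
    using \<alpha>N \<open>m \<ge> 3\<close> by auto
  have \<beta>N: "\<beta> * cnj \<beta> = of_int (m ^ (2 * p))"
  proof -
    have "\<beta> * cnj \<beta> = of_int (1 - m ^ p) * of_int (1 - m ^ p) - \<theta> * \<theta>"
      by (simp add: \<beta>_def \<theta>(3) algebra_simps)
    also have "\<dots> = of_int ((m ^ p) ^ 2)"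
      unfolding \<theta>(2) by (simp add: power2_eq_square algebra_simps)
    also have "(m ^ p) ^ 2 = m ^ (2 * p)"
      by (simp add: mult.commute flip: power_mult)
    finally show ?thesis .
  qed
  have "\<beta> \<noteq> 0" using \<alpha>\<beta> \<open>\<alpha> \<noteq> 0\<close> by auto
  have "\<kappa> \<noteq> 0"
  proof
    assume "\<kappa> = 0"
    have "principal (\<kappa> ^ p) = principal \<beta>"
      using pow unfolding principal_pow \<beta>_def .
    then have "\<beta> \<in> principal (\<kappa> ^ p)"
      using imageI[OF integers_of_int[of 1], of "\<lambda>y. \<beta> * y"] by simp
    then show False using \<open>\<kappa> = 0\<close> \<open>\<beta> \<noteq> 0\<close> p(2) by (auto simp: power_0_left)
  qed
  have "principal (\<kappa> ^ p) = principal \<beta>"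
    using pow unfolding principal_pow \<beta>_def .
  moreover have "\<kappa> ^ p \<noteq> 0" using \<open>\<kappa> \<noteq> 0\<close> by simp
  ultimately obtain \<epsilon> where \<epsilon>: "\<epsilon> \<in> \<O>" "\<epsilon> * cnj \<epsilon> = 1" "\<beta> = \<kappa> ^ p * \<epsilon>"
    using \<open>\<beta> \<noteq> 0\<close> by (rule principal_eqD)
  define \<nu> where "\<nu> = \<kappa> * \<epsilon> ^ p"
  have "\<nu> \<in> \<O>" unfolding \<nu>_def by (intro integers_mult integers_power \<kappa> \<epsilon>)
  have "\<nu> \<noteq> 0" using \<open>\<kappa> \<noteq> 0\<close> \<epsilon>(2) by (auto simp: \<nu>_def)
  have "\<epsilon> ^ (p\<^sup>2) = \<epsilon>"
  proof -
    have "p\<^sup>2 = 12 * (p\<^sup>2 div 12) + 1"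
      using prime_square_mod_12[OF p] by (metis mult_div_mod_eq)
    then have "\<epsilon> ^ (p\<^sup>2) = (\<epsilon> ^ 12) ^ (p\<^sup>2 div 12) * \<epsilon>"
      by (metis power_add power_mult power_one_right)
    then show ?thesis using unit_power_12[OF \<epsilon>(1,2)] by simp
  qed
  then have \<nu>p: "\<nu> ^ p = \<beta>"
    unfolding \<nu>_def \<epsilon>(3) by (simp add: power_mult_distrib power2_eq_square flip: power_mult)
  obtain Nl where Nl: "\<nu> * cnj \<nu> = of_int Nl"
    using \<open>\<nu> \<in> \<O>\<close> by (auto simp: integers_iff elim: Ints_cases)
  have "real_of_int Nl = (cmod \<nu>)\<^sup>2"
    using Nl unfolding norm_eq_of_real by (metis of_real_eq_iff of_real_of_int_eq)
  then have "Nl \<ge> 0"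
    by (metis of_int_0_le_iff zero_le_power2)
  have "of_int (Nl ^ p) = \<nu> ^ p * cnj (\<nu> ^ p)"
    by (simp add: Nl[symmetric] power_mult_distrib)
  also have "\<dots> = of_int (m ^ (2 * p))"
    unfolding \<nu>p by (rule \<beta>N)
  finally have "Nl ^ p = (m ^ 2) ^ p"
    by (simp only: of_int_eq_iff power_mult)
  then have Nl_eq: "Nl = m ^ 2"
    using \<open>Nl \<ge> 0\<close> p by (simp add: power_eq_iff_eq_base)
  obtain Tl where Tl: "\<nu> + cnj \<nu> = of_int Tl"
    using \<open>\<nu> \<in> \<O>\<close> by (auto simp: integers_iff elim: Ints_cases)
  define \<gamma> where "\<gamma> = \<alpha> / \<nu> ^ q"
  have "\<gamma> \<in> K"
    unfolding \<gamma>_def \<alpha>_def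
    by (intro divide_mem add_mem one_mem \<theta> power_mem integers_mem \<open>\<nu> \<in> \<O>\<close>)
  have \<gamma>2: "\<gamma> ^ 2 = 2 * \<nu>"
  proof -
    have "\<gamma> ^ 2 = 2 * \<nu> ^ p / \<nu> ^ (2 * q)"
      unfolding \<gamma>_def power_divide \<alpha>\<beta> \<nu>p by (simp add: power_mult[symmetric] mult.commute)
    also have "\<dots> = 2 * \<nu>"
      unfolding pq using \<open>\<nu> \<noteq> 0\<close> by simp
    finally show ?thesis .
  qed
  have \<gamma>p: "\<gamma> ^ p = 2 ^ q * \<alpha>"
  proof -
    have "\<gamma> ^ p = (\<gamma> ^ 2) ^ q * \<gamma>"
      unfolding pq by (simp add: power_mult)
    also have "\<dots> = 2 ^ q * \<nu> ^ q * (\<alpha> / \<nu> ^ q)"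
      unfolding \<gamma>2 power_mult_distrib by (simp only: \<gamma>_def)
    also have "\<dots> = 2 ^ q * \<alpha>"
      using \<open>\<nu> \<noteq> 0\<close> by simp
    finally show ?thesis .
  qed
  have "2 * \<nu> \<in> \<O>"
    using integers_mult[OF integers_of_int[of 2] \<open>\<nu> \<in> \<O>\<close>] by simp
  then have "algebraic_int (\<gamma> ^ 2)"
    unfolding \<gamma>2 by (simp add: ring_of_integers_def)
  then have "algebraic_int \<gamma>"
    by (rule algebraic_int_root[where p = "monom 1 2"]) (auto simp: poly_monom degree_monom_eq)
  with \<open>\<gamma> \<in> K\<close> have "\<gamma> \<in> \<O>" by (simp add: ring_of_integers_def)
  then obtain T where T: "\<gamma> + cnj \<gamma> = of_int T"
    by (auto simp: integers_iff elim: Ints_cases)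
  obtain N where N: "\<gamma> * cnj \<gamma> = of_int N"
    using \<open>\<gamma> \<in> \<O>\<close> by (auto simp: integers_iff elim: Ints_cases)
  have "real_of_int N = (cmod \<gamma>)\<^sup>2"
    using N unfolding norm_eq_of_real by (metis of_real_eq_iff of_real_of_int_eq)
  then have "N \<ge> 0"
    by (metis of_int_0_le_iff zero_le_power2)
  have "of_int (N ^ 2) = (\<gamma> ^ 2) * cnj (\<gamma> ^ 2)"
    by (simp add: N[symmetric] power_mult_distrib)
  also have "\<dots> = 4 * (\<nu> * cnj \<nu>)"
    unfolding \<gamma>2 by simp
  also have "\<dots> = of_int ((2 * m) ^ 2)"
    unfolding Nl Nl_eq by (simp add: power_mult_distrib)
  finally have "N ^ 2 = (2 * m) ^ 2"
    by (simp only: of_int_eq_iff)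
  then have N_eq: "N = 2 * m"
    by (rule power2_eq_imp_eq) (use \<open>N \<ge> 0\<close> \<open>m \<ge> 3\<close> in simp_all)
  have "of_int (T ^ 2) = (\<gamma> + cnj \<gamma>) ^ 2"
    unfolding T by simp
  also have "\<dots> = \<gamma> ^ 2 + cnj (\<gamma> ^ 2) + 2 * (\<gamma> * cnj \<gamma>)"
    by (simp add: power2_eq_square algebra_simps)
  also have "\<dots> = 2 * (\<nu> + cnj \<nu>) + 2 * of_int N"
    unfolding \<gamma>2 N by simp
  also have "\<dots> = of_int (2 * (Tl + N))"
    unfolding Tl by simp
  finally have "T ^ 2 = 2 * (Tl + N)"
    by (simp only: of_int_eq_iff)
  then have "even (T ^ 2)" by simp
  then have "even T" by simp
  have "\<not> 4 dvd T"
  proof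
    assume "4 dvd T"
    then obtain x where x: "T = 4 * x" by blast
    \<comment> \<open>This is the part of \<gamma> of trace zero, so y / \<theta> is rational. But
      y^2 = T^2 / 4 - N = -2 (m - 2 x^2) is twice an odd number, while \<theta>^2 is odd.\<close>
    define y where "y = \<gamma> - of_int (2 * x)"
    have cnj_y: "cnj y = - y"
      using T unfolding y_def x by (simp add: algebra_simps)
    have "\<gamma> ^ 2 = of_int T * \<gamma> - of_int N"
      unfolding T[symmetric] N[symmetric] by (simp add: power2_eq_square algebra_simps)
    then have y2: "y * y = of_int (- 2 * (m - 2 * x ^ 2))"
      unfolding y_def x N_eq by (simp add: power2_eq_square algebra_simps)
    have "y \<in> K" unfolding y_def by (intro diff_mem \<open>\<gamma> \<in> K\<close> of_int_mem)
    then have "y / \<theta> + cnj (y / \<theta>) \<in> \<rat>"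
      by (intro trace_rat divide_mem \<theta>)
    then have "2 * (y / \<theta>) \<in> \<rat>"
      by (simp add: cnj_y \<theta>(3))
    then have "2 * (y / \<theta>) / 2 \<in> \<rat>"
      by (rule Rats_divide) simp
    then have "y / \<theta> \<in> \<rat>" by simp
    then obtain c d where cd: "d > 0" "y / \<theta> = of_int c / of_int d"
      by (elim Rats_cases') auto
    have "1 - 2 * m ^ p \<noteq> 0" using mp by simp
    then have "\<theta> \<noteq> 0" using \<theta>(2) by (metis mult_zero_left of_int_eq_0_iff)
    have "y * of_int d = of_int c * \<theta>"
      using cd \<open>\<theta> \<noteq> 0\<close> by (simp add: field_simps)
    then have "(y * y) * of_int (d ^ 2) = of_int (c ^ 2) * (\<theta> * \<theta>)"
      by (simp add: power2_eq_square) (metis mult.commute mult.assoc)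
    then have "of_int (- 2 * (m - 2 * x ^ 2) * d ^ 2) = (of_int (c ^ 2 * (1 - 2 * m ^ p)) :: complex)"
      unfolding y2 \<theta>(2) by (simp only: of_int_mult)
    then have "- 2 * (m - 2 * x ^ 2) * d ^ 2 = c ^ 2 * (1 - 2 * m ^ p)"
      by (simp only: of_int_eq_iff)
    then have "(2 * m ^ p - 1) * c ^ 2 = 2 * (m - 2 * x ^ 2) * d ^ 2"
      by (simp add: algebra_simps)
    moreover have "odd (2 * m ^ p - 1)" "odd (m - 2 * x ^ 2)"
      using \<open>odd m\<close> by simp_all
    ultimately show False
      using odd_times_square_neq cd(1) by (metis less_irrefl)
  qed
  have sum: "\<gamma> ^ p + cnj \<gamma> ^ p = of_int (2 ^ (q + 1))"
  proof -
    have "\<gamma> ^ p + cnj \<gamma> ^ p = \<gamma> ^ p + cnj (\<gamma> ^ p)"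
      by simp
    also have "\<dots> = 2 ^ q * (\<alpha> + cnj \<alpha>)"
      unfolding \<gamma>p by (simp add: algebra_simps)
    also have "\<alpha> + cnj \<alpha> = 2"
      by (simp add: \<alpha>_def \<theta>(3))
    finally show ?thesis by simp
  qed
  obtain z where "\<gamma> ^ p + cnj \<gamma> ^ p = of_int (T * z)"
    using trace_dvd_odd_power_sum[OF T N, of q] pq by auto
  then have "2 ^ (q + 1) = T * z"
    using sum by (metis of_int_eq_iff)
  obtain x where x: "T = 2 * x" using \<open>even T\<close> by blast
  have "odd x"
    using \<open>\<not> 4 dvd T\<close> unfolding x by presburger
  have "x dvd 2 ^ (q + 1)"
    unfolding \<open>2 ^ (q + 1) = T * z\<close> x by simp
  moreover have "Rings.coprime x (2 ^ (q + 1))"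
    using \<open>odd x\<close> by simp
  ultimately have "is_unit x"
    by (metis coprime_common_divisor dvd_refl)
  then have x1: "\<bar>x\<bar> = 1" by simp
  then have xx: "x * x = 1" by (metis abs_mult_self_eq mult_1)
  \<comment> \<open>The sign x normalises the trace to 2; with norm 2 m = 2 (1 + 2 s) this is the
    situation of \<open>half_trace_power_sum\<close>. As p is odd, the sign survives in the p-th
    power.\<close>
  define \<delta> where "\<delta> = of_int x * \<gamma>"
  have cnj_\<delta>: "cnj \<delta> = of_int x * cnj \<gamma>" by (simp add: \<delta>_def)
  have "\<delta> + cnj \<delta> = of_int x * (\<gamma> + cnj \<gamma>)"
    unfolding cnj_\<delta> by (simp add: \<delta>_def algebra_simps)
  also have "\<dots> = of_int (2 * (x * x))"
    unfolding T x by simp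
  finally have 1: "\<delta> + cnj \<delta> = 2" unfolding xx by simp
  have "\<delta> * cnj \<delta> = of_int (x * x) * (\<gamma> * cnj \<gamma>)"
    unfolding cnj_\<delta> by (simp add: \<delta>_def)
  then have 2: "\<delta> * cnj \<delta> = of_int (2 * (1 + 2 * s))"
    unfolding N N_eq xx m_def by simp
  have "x ^ p = x"
    unfolding pq using xx by (simp add: power_mult power2_eq_square)
  have "of_int (2 ^ (q + 1) * half_trace s q) = \<delta> ^ p + cnj \<delta> ^ p"
    using half_trace_power_sum[OF 1 2, of q] pq by simp
  also have "\<dots> = of_int (x ^ p) * (\<gamma> ^ p + cnj \<gamma> ^ p)"
    unfolding cnj_\<delta> by (simp add: \<delta>_def power_mult_distrib algebra_simps)
  also have "\<dots> = of_int (2 ^ (q + 1) * x)"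
    unfolding sum \<open>x ^ p = x\<close> by simp
  finally have "2 ^ (q + 1) * half_trace s q = 2 ^ (q + 1) * x"
    by (simp only: of_int_eq_iff)
  then have "half_trace s q = x" by simp
  then show ?thesis using x1 by (simp add: q_def)
qed

end

section \<open>Divisibility of the class number\<close>

context quadratic_subfield
begin

lemma principal_if_two_prime_powers:
  assumes A: "A \<in> \<F>" and p: "Factorial_Ring.prime p" "Factorial_Ring.prime (q::nat)" "p \<noteq> q"
    and "A [^]\<^bsub>G\<^esub> p \<in> PI" "A [^]\<^bsub>G\<^esub> q \<in> PI"
  shows "A \<in> PI"
proof -
  obtain n where n: "\<And>k. A [^]\<^bsub>G\<^esub> (k::nat) \<in> PI \<longleftrightarrow> n dvd k"
    using ideal_class_order[OF A] by blast
  have "n dvd p" "n dvd q" using n assms by blast+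
  moreover have "Rings.coprime p q" using p by (rule primes_coprime)
  ultimately have "n dvd 1"
    by (metis coprime_common_divisor)
  then have "A [^]\<^bsub>G\<^esub> (Suc 0) \<in> PI" unfolding n by simp
  then show ?thesis
    unfolding pow_Suc_fractional pow_0_fractional integers_prod[OF A] .
qed

lemma prime_dvd_class_number:
  assumes A: "A \<in> \<F>" and p: "Factorial_Ring.prime p" "A [^]\<^bsub>G\<^esub> p \<in> PI" "A \<notin> PI"
  shows "p dvd class_number K"
proof -
  obtain n where n: "n dvd class_number K" "\<And>k. A [^]\<^bsub>G\<^esub> (k::nat) \<in> PI \<longleftrightarrow> n dvd k"
    using ideal_class_order[OF A] by blast
  have "A [^]\<^bsub>G\<^esub> (Suc 0) \<notin> PI"
    unfolding pow_Suc_fractional pow_0_fractional integers_prod[OF A] by (rule p(3))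
  then have "n \<noteq> 1" unfolding n(2) by (metis one_dvd)
  moreover have "n dvd p" using n(2) p(2) by blast
  ultimately have "n = p" using p(1) unfolding prime_nat_iff by blast
  then show ?thesis using n(1) by simp
qed

text \<open>The square root is an argument so that the ideals for different exponents can be
  compared inside one field.\<close>

definition root_ideal :: "int \<Rightarrow> nat \<Rightarrow> complex \<Rightarrow> complex set" where
  "root_ideal m p \<theta> = two_generated (m ^ 2) (of_int (1 - m ^ p) + \<theta>)"

context
  fixes s m :: int and p :: nat and \<theta> :: complex
  assumes m: "m = 1 + 2 * s" and s: "s \<ge> 1"
    and \<theta>: "\<theta> \<in> K" "\<theta> * \<theta> = of_int (1 - 2 * m ^ p)" "cnj \<theta> = - \<theta>"
    and p: "Factorial_Ring.prime p" "p > 3"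
begin

private abbreviation "\<beta> \<equiv> of_int (1 - m ^ p) + \<theta>"

lemma root_trace: "\<beta> + cnj \<beta> = of_int (2 * (1 - m ^ p))"
  by (simp add: \<theta>(3))

lemma root_norm: "\<beta> * cnj \<beta> = of_int ((m ^ 2) ^ p)"
proof -
  have "\<beta> * cnj \<beta> = of_int (1 - m ^ p) * of_int (1 - m ^ p) - \<theta> * \<theta>"
    by (simp add: \<theta>(3) algebra_simps)
  also have "\<dots> = of_int (m ^ p * m ^ p)"
    unfolding \<theta>(2) by (simp add: algebra_simps)
  also have "m ^ p * m ^ p = (m ^ 2) ^ p"
    by (simp add: power2_eq_square power_mult_distrib)
  finally show ?thesis .
qed

lemma root_integer: "\<beta> \<in> \<O>"
  unfolding integers_iff root_trace root_norm
  by (intro conjI add_mem of_int_mem \<theta>(1) Ints_of_int)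

lemma root_ideal_fractional: "root_ideal m p \<theta> \<in> \<F>"
  unfolding root_ideal_def using m s by (intro two_generated_fractional root_integer) simp

text \<open>The trace 2 (1 - m^p) is coprime to the norm because m is odd and prime to 1 -
  m^p.\<close>

lemma root_ideal_pow: "root_ideal m p \<theta> [^]\<^bsub>G\<^esub> p = principal \<beta>"
  unfolding root_ideal_def
proof (rule two_generated_pow[OF root_integer root_trace root_norm])
  have "Rings.coprime (1 - m ^ p) m"
  proof (rule coprimeI)
    fix c assume "c dvd 1 - m ^ p" "c dvd m"
    then have "c dvd (1 - m ^ p) + m ^ p"
      using p(2) by (intro dvd_add dvd_power_same dvd_trans[OF _ dvd_power]) auto
    then show "is_unit c" by simp
  qed
  moreover have "Rings.coprime 2 m" using m by simp
  ultimately show "Rings.coprime (2 * (1 - m ^ p)) ((m ^ 2) ^ p)"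
    by (simp only: coprime_mult_left_iff coprime_power_right_iff) simp
qed (use m s p in auto)

lemma root_ideal_pow_principal: "root_ideal m p \<theta> [^]\<^bsub>G\<^esub> p \<in> PI"
proof -
  have "\<beta> \<noteq> 0"
  proof
    assume "\<beta> = 0"
    then have "of_int ((m ^ 2) ^ p) = (0::complex)"
      using root_norm by simp
    then have "(m ^ 2) ^ p = 0"
      by (simp only: of_int_eq_0_iff)
    then show False using m s by simp
  qed
  then show ?thesis
    unfolding root_ideal_pow principal_fractional_ideals_iff
    using integers_mem[OF root_integer] by blast
qed

lemma root_ideal_not_principal:
  assumes "\<bar>half_trace s ((p - 1) div 2)\<bar> \<noteq> 1"
  shows "root_ideal m p \<theta> \<notin> PI"
proof
  assume "root_ideal m p \<theta> \<in> PI"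
  then obtain \<kappa> where \<kappa>: "root_ideal m p \<theta> = principal \<kappa>"
    unfolding principal_fractional_ideals_iff by blast
  \<comment> \<open>A generator of a principal fractional ideal is only known to lie in K; as an
    element of this ideal it is integral.\<close>
  have "\<kappa> \<in> principal \<kappa>"
    using imageI[OF integers_of_int[of 1], of "\<lambda>y. \<kappa> * y"] by simp
  then have "\<kappa> \<in> two_generated (m ^ 2) \<beta>"
    unfolding \<kappa>[symmetric] root_ideal_def .
  then obtain u v where uv: "u \<in> \<O>" "v \<in> \<O>" "\<kappa> = of_int (m ^ 2) * u + \<beta> * v"
    by (rule two_generated_E)
  have "\<kappa> \<in> \<O>"
    unfolding uv(3) by (intro integers_add integers_mult integers_of_int uv root_integer)
  moreover have "principal \<kappa> [^]\<^bsub>G\<^esub> p = principal \<beta>"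
    using root_ideal_pow unfolding \<kappa> .
  ultimately show False
    using principal_root_trace[OF \<theta>(1) _ \<theta>(3) s p, of \<kappa>] \<theta>(2) assms unfolding m by blast
qed

end

end

section \<open>Infinitely many fields\<close>

lemma csqrt_discriminant:
  fixes m :: int
  assumes "m \<ge> 3"
  shows "1 - 2 * m ^ p < 0"
    "csqrt (of_int (1 - 2 * m ^ p)) * csqrt (of_int (1 - 2 * m ^ p)) = of_int (1 - 2 * m ^ p)"
    "cnj (csqrt (of_int (1 - 2 * m ^ p))) = - csqrt (of_int (1 - 2 * m ^ p))"
proof -
  have "m ^ p \<ge> 1" using assms by simp
  then show neg: "1 - 2 * m ^ p < 0" by linarith
  show "cnj (csqrt (of_int (1 - 2 * m ^ p))) = - csqrt (of_int (1 - 2 * m ^ p))"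
    using neg by (rule cnj_csqrt_neg)
  show "csqrt (of_int (1 - 2 * m ^ p)) * csqrt (of_int (1 - 2 * m ^ p)) = of_int (1 - 2 * m ^ p)"
    by (simp only: power2_eq_square[symmetric] power2_csqrt)
qed

text \<open>
  If \<open>\<theta> p\<close> and \<open>\<theta> q\<close> are congruent mod \<open>m\<^sup>2\<close>, then the ideals for \<open>p\<close> and \<open>q\<close> coincide, so their class is
  annihilated by two coprime exponents. The integers \<open>e p = \<theta> p * \<theta> r\<close> detect this congruence.
\<close>

lemma (in quadratic_subfield) finite_primes_with_common_field:
  fixes s m :: int
  assumes m: "m = 1 + 2 * s" and s: "s \<ge> 1"
    and P: "\<And>p. p \<in> P \<Longrightarrow> Factorial_Ring.prime p \<and> p > 3 \<and> \<bar>half_trace s ((p - 1) div 2)\<bar> \<noteq> 1 \<and>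
      csqrt (of_int (1 - 2 * m ^ p)) \<in> K"
  shows "finite P"
proof (cases "P = {}")
  case False
  then obtain r where r: "r \<in> P" by blast
  define n where "n p = 1 - 2 * m ^ p" for p :: nat
  define \<theta> where "\<theta> p = csqrt (of_int (n p))" for p
  have "m \<ge> 3" using m s by simp
  note \<theta> = csqrt_discriminant[OF this, folded n_def, folded \<theta>_def]
  have \<theta>K: "\<theta> p \<in> K" if "p \<in> P" for p
    using P[OF that] by (simp add: \<theta>_def n_def)
  have \<theta>O: "\<theta> p \<in> \<O>" if "p \<in> P" for p
  proof -
    have "\<theta> p * cnj (\<theta> p) = of_int (- n p)"
      using \<theta>(2)[of p] by (simp add: \<theta>(3))
    then show ?thesis
      unfolding integers_iff using \<theta>K[OF that] by (simp add: \<theta>(3))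
  qed
  \<comment> \<open>Both square roots are negated by conjugation, so their product is fixed by it
    and hence rational; it is also integral.\<close>
  have "\<exists>e. \<theta> p * \<theta> r = of_int e" if p: "p \<in> P" for p
  proof -
    have "\<theta> p * \<theta> r \<in> \<O>" by (intro integers_mult \<theta>O p r)
    moreover have "(\<theta> p * \<theta> r + cnj (\<theta> p * \<theta> r)) / 2 \<in> \<rat>"
      by (intro Rats_divide trace_rat mult_mem \<theta>K p r) simp
    then have "\<theta> p * \<theta> r \<in> \<rat>" by (simp add: \<theta>(3))
    ultimately have "\<theta> p * \<theta> r \<in> \<int>" by (rule integers_rat)
    then show ?thesis by (elim Ints_cases) blast
  qed
  then obtain e where e: "\<And>p. p \<in> P \<Longrightarrow> \<theta> p * \<theta> r = of_int (e p)" by metis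
  \<comment> \<open>The factor n r pays for the division by \<theta> r: (e p - e q) \<theta> r = n r
    (\<theta> p - \<theta> q), which leaves a congruence modulo m^2.\<close>
  define M where "M = m ^ 2 * n r"
  have "n r \<noteq> 0" using \<theta>(1)[of r] by simp
  then have "M \<noteq> 0" using \<open>m \<ge> 3\<close> by (simp add: M_def)
  have "inj_on (\<lambda>p. e p mod M) P"
  proof (rule inj_onI, rule ccontr)
    fix p q assume pq: "p \<in> P" "q \<in> P" "e p mod M = e q mod M" "p \<noteq> q"
    then have "M dvd e p - e q" by (simp add: mod_eq_dvd_iff)
    then obtain k where k: "e p = e q + M * k" by (metis add.commute diff_add_cancel dvdE)
    have "of_int (n r) * (\<theta> p - \<theta> q) = (\<theta> p * \<theta> r - \<theta> q * \<theta> r) * \<theta> r"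
      unfolding \<theta>(2)[symmetric] by (simp add: algebra_simps)
    also have "\<dots> = of_int (n r) * (of_int (m ^ 2) * (of_int k * \<theta> r))"
      unfolding e[OF pq(1)] e[OF pq(2)] k M_def by simp
    finally have \<theta>_diff: "\<theta> p - \<theta> q = of_int (m ^ 2) * (of_int k * \<theta> r)"
      using \<open>n r \<noteq> 0\<close> by simp
    \<comment> \<open>The exponents exceed 2, so m^p and m^q vanish modulo m^2 and the second
      generators are congruent as soon as the square roots are; w is the quotient of their
      difference by m^2.\<close>
    have two: "m ^ j = m ^ 2 * m ^ (j - 2)" if "j > 3" for j :: nat
    proof -
      have "2 + (j - 2) = j" using that by linarith
      then show ?thesis by (metis power_add)
    qed
    define w where "w = of_int (m ^ (q - 2) - m ^ (p - 2)) + of_int k * \<theta> r"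
    have "w \<in> \<O>"
      unfolding w_def by (intro integers_add integers_mult integers_of_int \<theta>O r)
    moreover have "of_int (1 - m ^ p) + \<theta> p = of_int (1 - m ^ q) + \<theta> q + of_int (m ^ 2) * w"
    proof -
      have "\<theta> p = \<theta> q + of_int (m ^ 2) * (of_int k * \<theta> r)"
        using \<theta>_diff by (simp add: algebra_simps)
      moreover have "of_int (1 - m ^ p) = (of_int (1 - m ^ q) + of_int (m ^ 2) * of_int (m ^ (q - 2) - m ^ (p - 2)) :: complex)"
        using P[OF pq(1)] P[OF pq(2)] two[of p] two[of q] by (simp add: algebra_simps)
      ultimately show ?thesis
        unfolding w_def by (simp only: distrib_left add_ac)
    qed
    ultimately have eq: "root_ideal m p (\<theta> p) = root_ideal m q (\<theta> q)"
      unfolding root_ideal_def by (rule two_generated_cong)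
    have "root_ideal m p (\<theta> p) [^]\<^bsub>G\<^esub> p \<in> PI"
      by (rule root_ideal_pow_principal[OF m s \<theta>K[OF pq(1)]])
        (use P[OF pq(1)] \<theta>(2,3)[of p] in \<open>simp_all add: n_def\<close>)
    moreover have "root_ideal m p (\<theta> p) [^]\<^bsub>G\<^esub> q \<in> PI"
      unfolding eq by (rule root_ideal_pow_principal[OF m s \<theta>K[OF pq(2)]])
        (use P[OF pq(2)] \<theta>(2,3)[of q] in \<open>simp_all add: n_def\<close>)
    moreover have "root_ideal m p (\<theta> p) \<in> \<F>"
      by (rule root_ideal_fractional[OF m s \<theta>K[OF pq(1)]])
        (use P[OF pq(1)] \<theta>(2,3)[of p] in \<open>simp_all add: n_def\<close>)
    ultimately have "root_ideal m p (\<theta> p) \<in> PI"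
      using principal_if_two_prime_powers P[OF pq(1)] P[OF pq(2)] pq(4) by metis
    moreover have "root_ideal m p (\<theta> p) \<notin> PI"
      by (rule root_ideal_not_principal[OF m s \<theta>K[OF pq(1)]])
        (use P[OF pq(1)] \<theta>(2,3)[of p] in \<open>simp_all add: n_def\<close>)
    ultimately show False by blast
  qed
  moreover have "finite ((\<lambda>p. e p mod M) ` P)"
  proof (rule finite_subset)
    show "(\<lambda>p. e p mod M) ` P \<subseteq> {- \<bar>M\<bar>..\<bar>M\<bar>}"
    proof (rule image_subsetI)
      fix p
      show "e p mod M \<in> {- \<bar>M\<bar>..\<bar>M\<bar>}"
        using abs_mod_less[OF \<open>M \<noteq> 0\<close>, of "e p"] unfolding atLeastAtMost_iff by linarith
    qed
  qed simp
  ultimately show ?thesis by (rule finite_imageD[rotated])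
qed simp

theorem theorem6:
  fixes m :: int
  assumes "m \<ge> 3" and "odd m"
  shows "finite {p :: nat. Factorial_Ring.prime p \<and>
           \<not> p dvd class_number (rat_sqrt_field (1 - 2 * m ^ p))} \<and>
         infinite {rat_sqrt_field (1 - 2 * m ^ p) | p :: nat. Factorial_Ring.prime p \<and>
           p dvd class_number (rat_sqrt_field (1 - 2 * m ^ p))}"
proof -
  obtain s where m: "m = 1 + 2 * s"
    using assms(2) by (elim oddE) simp
  have s: "s \<ge> 1" using assms(1) m by simp
  define K where "K = (\<lambda>p::nat. rat_sqrt_field (1 - 2 * m ^ p))"
  \<comment> \<open>The primes 2 and 3 are removed because the argument with units needs p prime to
    12; the other members are the exponents p = 2 k + 1 at which the ideal might be
    principal.\<close>
  define bad where "bad = {..3} \<union> (\<lambda>k. 2 * k + 1) ` {k. \<bar>half_trace s k\<bar> = 1}"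
  have "finite bad"
    unfolding bad_def using finite_half_trace_unit[OF s] by simp
  define P where "P = {p::nat. Factorial_Ring.prime p} - bad"
  have "infinite P"
    unfolding P_def using primes_infinite \<open>finite bad\<close> by (rule Diff_infinite_finite[rotated])
  have P: "Factorial_Ring.prime p \<and> p > 3 \<and> \<bar>half_trace s ((p - 1) div 2)\<bar> \<noteq> 1" if "p \<in> P" for p
  proof -
    have p: "Factorial_Ring.prime p" "p > 3" "p \<notin> bad"
      using that by (auto simp: P_def bad_def)
    then have "odd p" using prime_odd_nat[of p] by simp
    then have "p = 2 * ((p - 1) div 2) + 1" by presburger
    then have "\<bar>half_trace s ((p - 1) div 2)\<bar> \<noteq> 1"
      using p(3) unfolding bad_def by blast
    with p show ?thesis by simp
  qed
  note \<theta> = csqrt_discriminant[OF assms(1)]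
  have quad: "quadratic_subfield (K p)" for p
    unfolding K_def using \<theta>(1) by (rule quadratic_subfield_rat_sqrt_field)
  have mem: "csqrt (of_int (1 - 2 * m ^ p)) \<in> K p" for p
    unfolding K_def by (rule csqrt_mem_rat_sqrt_field)
  have dvd: "p dvd class_number (K p)" if "p \<in> P" for p
  proof -
    interpret quadratic_subfield "K p" by (rule quad)
    have p: "Factorial_Ring.prime p" "p > 3" "\<bar>half_trace s ((p - 1) div 2)\<bar> \<noteq> 1"
      using P[OF that] by auto
    note root = m s mem \<theta>(2,3) p(1,2)
    show ?thesis
      using root_ideal_fractional[OF root] p(1) root_ideal_pow_principal[OF root]
        root_ideal_not_principal[OF root p(3)]
      by (rule prime_dvd_class_number)
  qed
  have "{p. Factorial_Ring.prime p \<and> \<not> p dvd class_number (K p)} \<subseteq> bad"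
    using dvd by (auto simp: P_def)
  then have 1: "finite {p. Factorial_Ring.prime p \<and> \<not> p dvd class_number (K p)}"
    using \<open>finite bad\<close> by (rule finite_subset)
  have "infinite (K ` P)"
  proof
    \<comment> \<open>With finitely many fields, one of them would belong to infinitely many primes
      of P, against \<open>finite_primes_with_common_field\<close>.\<close>
    assume "finite (K ` P)"
    then obtain r where r: "r \<in> P" "infinite {p \<in> P. K p = K r}"
      using pigeonhole_infinite[OF \<open>infinite P\<close>] by blast
    interpret quadratic_subfield "K r" by (rule quad)
    have "finite {p \<in> P. K p = K r}"
    proof (rule finite_primes_with_common_field[OF m s])
      fix p assume "p \<in> {p \<in> P. K p = K r}"
      then show "Factorial_Ring.prime p \<and> p > 3 \<and> \<bar>half_trace s ((p - 1) div 2)\<bar> \<noteq> 1 \<and>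
          csqrt (of_int (1 - 2 * m ^ p)) \<in> K r"
        using P mem by (metis (mono_tags, lifting) mem_Collect_eq)
    qed
    with r(2) show False ..
  qed
  moreover have "K ` P \<subseteq> {K p | p. Factorial_Ring.prime p \<and> p dvd class_number (K p)}"
    using dvd P by blast
  ultimately have "infinite {K p | p. Factorial_Ring.prime p \<and> p dvd class_number (K p)}"
    using infinite_super by blast
  with 1 show ?thesis
    unfolding K_def by blast
qed

end
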